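(* Let $A:[0,\infty)\to\mathbb{R}^{d\times d}$ be continuous and bounded, and let the system $\dot x=A(t)x$ have Lyapunov exponents $\lambda_1>\dots>\lambda_q$ with multiplicities $d_1,\dots,d_q$. Assume the system is regular and $(d_1+\dots+d_l)$-dimensionally strongly fast invertible for every $l=1,\dots,q$. Let $\Phi$ be a one-step method for this system that is consistent of order $p>0$. Then for Lebesgue-almost every tuple of initial vectors $(v_1,\dots,v_d)\in(\mathbb{R}^d)^d$ there exists $\epsilon>0$ such that for every sequence of stepsizes $(h_n)_{n\ge1}$ with $0<h_n\le h_{\max}$, $t_n=h_1+\dots+h_n\to\infty$ and $\sum_{n=1}^\infty h_n^{p+1}<\epsilon$, the outputs $\mu_i(n)$ of Benettin's algorithm satisfy $$d_i\lambda_i=\lim_{n\to\infty}\big(\mu_{d_1+\dots+d_{i-1}+1}(n)+\dots+\mu_{d_1+\dots+d_i}(n)\big)$$ for all $i=1,\dots,q$. In particular, if the Lyapunov spectrum is simple (all $d_i=1$), then $\lambda_i=\lim_{n\to\infty}\mu_i(n)$ for all $i$.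
   Context: Norms are Euclidean norms and associated operator norms. $X(t)$ denotes a fundamental matrix of $\dot x=A(t)x$ and $X(t,s)=X(t)X(s)^{-1}$ the Cauchy matrix. Lyapunov exponents: for a solution $x$ put $\chi[x]=\limsup_{t\to\infty}\frac1t\log\|x(t)\|$. The distinct values of $\chi$ on non-trivial solutions are $\lambda_1>\dots>\lambda_q$; with $V_i=\{x \text{ solution}:\chi[x]\le\lambda_i\}$, $V_{q+1}=\{0\}$, the multiplicity of $\lambda_i$ is $d_i=\dim V_i-\dim V_{i+1}$, so $d_1+\dots+d_q=d$. The system is regular if $\sum_{i=1}^q d_i\lambda_i=\liminf_{t\to\infty}\frac1t\log|\det X(t)|$. The system is $L$-dimensionally strongly fast invertible ($1\le L\le d$) if $\sup_{t\ge s\ge\tau\ge 0}\prod_{k=1}^L\frac{\sigma_k(X(t,s))\sigma_k(X(s,\tau))}{\sigma_k(X(t,\tau))}<\infty$, where $\sigma_1\ge\dots\ge\sigma_d$ denote singular values. One-step method: fix $0<h_{\max}<\infty$. A (linear) one-step method is a map $\Phi:[0,\infty)\times[0,h_{\max}]\to GL(d,\mathbb{R})$. It is consistent of order $p>0$ if there is a constant $c_\Phi>0$ with $\|\Phi(t,h)-X(t+h,t)\|\le c_\Phi h^{p+1}$ for all $t\ge0$, $0\le h\le h_{\max}$. Given stepsizes, put $t_0=0$, $t_n=h_1+\dots+h_n$, $\Phi_n=\Phi(t_{n-1},h_n)$. Benettin's algorithm: start with $V_0=[v_1,\dots,v_d]$ (invertible for almost every tuple). For $n\ge1$ compute the QR-decomposition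 $\Phi_nV_{n-1}=Q_nR_n$ ($Q_n$ orthogonal, $R_n$ upper triangular with positive diagonal) and set $V_n=Q_n$. The output after $n$ steps is $\mu_i(n)=\frac1{t_n}\sum_{k=1}^n\log (R_k)_{ii}$, $i=1,\dots,d$. *)

theory Defs
  imports "HOL-Analysis.Analysis"
begin

text \<open>
  The dimension is the cardinality of the index type \<open>'n\<close>; its order fixes the order of rows and
  columns. Indices in the definitions below are natural numbers starting at 1, and \<open>idx k\<close> is the
  k-th smallest element of \<open>'n\<close> for \<open>1 \<le> k \<le> CARD('n)\<close>.
\<close>

type_synonym 'n mat = "real^'n^'n"

definition idx :: "nat \<Rightarrow> 'n::{finite,wellorder}" where
  "idx k = sorted_list_of_set (UNIV :: 'n set) ! (k - 1)"


definition solution :: "(real \<Rightarrow> real^'n^'n) \<Rightarrow> (real \<Rightarrow> real^'n) \<Rightarrow> bool" where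
  "solution A x \<longleftrightarrow> (\<forall>t\<ge>0. (x has_vector_derivative A t *v x t) (at t within {0..}))"

definition fundamental_matrix :: "(real \<Rightarrow> real^'n^'n) \<Rightarrow> (real \<Rightarrow> real^'n^'n) \<Rightarrow> bool" where
  "fundamental_matrix A X \<longleftrightarrow>
     (\<forall>t\<ge>0. (X has_vector_derivative A t ** X t) (at t within {0..}) \<and> invertible (X t))"

definition cauchy_matrix :: "(real \<Rightarrow> real^'n^'n) \<Rightarrow> real \<Rightarrow> real \<Rightarrow> real^'n^'n" where
  "cauchy_matrix X t s = X t ** matrix_inv (X s)"


text \<open>The library has \<open>ln 0 = 0\<close>, so the convention \<open>log 0 = -\<infinity>\<close> is made explicit.\<close>

definition lyapunov_exponent :: "(real \<Rightarrow> real^'n) \<Rightarrow> ereal" where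
  "lyapunov_exponent x =
     Limsup at_top (\<lambda>t. if x t = 0 then -\<infinity> else ereal (ln (norm (x t)) / t))"

text \<open>
  The space of solutions with exponent at most \<open>l\<close>. A solution is identified with its value at time
  0, so that the space becomes a subspace of \<open>real^'n\<close> of the same dimension.
\<close>

definition lyapunov_space :: "(real \<Rightarrow> real^'n^'n) \<Rightarrow> real \<Rightarrow> (real^'n) set" where
  "lyapunov_space A l = {x 0 | x. solution A x \<and> lyapunov_exponent x \<le> ereal l}"

text \<open>
  \<open>lam 1 > \<dots> > lam q\<close> are the distinct exponents of the nontrivial solutions and \<open>m 1, \<dots>, m q\<close> their
  multiplicities; the last space of the filtration, with index \<open>q + 1\<close>, is trivial.
\<close>

definition lyapunov_spectrum ::
  "(real \<Rightarrow> real^'n^'n) \<Rightarrow> nat \<Rightarrow> (nat \<Rightarrow> real) \<Rightarrow> (nat \<Rightarrow> nat) \<Rightarrow> bool" where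
  "lyapunov_spectrum A q lam m \<longleftrightarrow>
     (\<forall>i\<in>{1..q}. \<forall>j\<in>{1..q}. i < j \<longrightarrow> lam j < lam i) \<and>
     {lyapunov_exponent x | x. solution A x \<and> (\<exists>t\<ge>0. x t \<noteq> 0)} = (\<lambda>i. ereal (lam i)) ` {1..q} \<and>
     (\<forall>i\<in>{1..q}. m i = dim (lyapunov_space A (lam i))
                       - dim (if i < q then lyapunov_space A (lam (i + 1)) else {0}))"

definition lyapunov_regular ::
  "(real \<Rightarrow> real^'n^'n) \<Rightarrow> nat \<Rightarrow> (nat \<Rightarrow> real) \<Rightarrow> (nat \<Rightarrow> nat) \<Rightarrow> bool" where
  "lyapunov_regular X q lam m \<longleftrightarrow>
     ereal (\<Sum>i=1..q. real (m i) * lam i) = Liminf at_top (\<lambda>t. ereal (ln \<bar>det (X t)\<bar> / t))"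


text \<open>
  The vector of singular values is the decreasing nonnegative diagonal of a singular value
  decomposition. It exists and does not depend on the decomposition, so the choice is immaterial.
\<close>

definition singular_values :: "'n::{finite,wellorder} mat \<Rightarrow> (real, 'n) vec" where
  "singular_values M = (SOME s. (\<forall>i. 0 \<le> s $ i) \<and> (\<forall>i j. i \<le> j \<longrightarrow> s $ j \<le> s $ i) \<and>
     (\<exists>U V. orthogonal_matrix U \<and> orthogonal_matrix V \<and>
            M = U ** (\<chi> i j. if i = j then s $ i else 0) ** transpose V))"

definition singular_value :: "nat \<Rightarrow> 'n::{finite,wellorder} mat \<Rightarrow> real" where
  "singular_value k M = singular_values M $ idx k"

definition strongly_fast_invertible ::
  "(real \<Rightarrow> 'n::{finite,wellorder} mat) \<Rightarrow> nat \<Rightarrow> bool" where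
  "strongly_fast_invertible X L \<longleftrightarrow>
     bdd_above {\<Prod>k=1..L. singular_value k (cauchy_matrix X t s) * singular_value k (cauchy_matrix X s \<tau>)
                          / singular_value k (cauchy_matrix X t \<tau>)
                | t s \<tau>. t \<ge> s \<and> s \<ge> \<tau> \<and> \<tau> \<ge> 0}"


definition one_step_method :: "real \<Rightarrow> (real \<Rightarrow> real \<Rightarrow> real^'n^'n) \<Rightarrow> bool" where
  "one_step_method hmax \<Phi> \<longleftrightarrow> (\<forall>t\<ge>0. \<forall>h\<in>{0..hmax}. invertible (\<Phi> t h))"

definition consistent_of_order ::
  "(real \<Rightarrow> real^'n^'n) \<Rightarrow> real \<Rightarrow> (real \<Rightarrow> real \<Rightarrow> real^'n^'n) \<Rightarrow> real \<Rightarrow> bool" where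
  "consistent_of_order X hmax \<Phi> p \<longleftrightarrow>
     (\<exists>c>0. \<forall>t\<ge>0. \<forall>h\<in>{0..hmax}.
        onorm ((*v) (\<Phi> t h - cauchy_matrix X (t + h) t)) \<le> c * h powr (p + 1))"


definition is_qr :: "'n::{finite,wellorder} mat \<Rightarrow> 'n mat \<Rightarrow> 'n mat \<Rightarrow> bool" where
  "is_qr M Q R \<longleftrightarrow> M = Q ** R \<and> orthogonal_matrix Q \<and>
     (\<forall>i j. j < i \<longrightarrow> R $ i $ j = 0) \<and> (\<forall>i. 0 < R $ i $ i)"

text \<open>For invertible \<open>M\<close> the decomposition exists and is unique; otherwise the value is arbitrary.\<close>

definition qr :: "'n::{finite,wellorder} mat \<Rightarrow> ('n mat) \<times> ('n mat)" where
  "qr M = (SOME (Q, R). is_qr M Q R)"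

text \<open>
  Stepsizes are \<open>h 1, h 2, \<dots>\<close>; the value \<open>h 0\<close> is never used. The columns of \<open>V0\<close> below are the
  initial vectors, so a tuple \<open>v\<close> with entries \<open>v $ j\<close> in \<open>real^'n\<close> enters as \<open>transpose v\<close>.
\<close>

definition grid :: "(nat \<Rightarrow> real) \<Rightarrow> nat \<Rightarrow> real" where
  "grid h n = (\<Sum>k=1..n. h k)"

primrec benettin_V ::
  "(real \<Rightarrow> real \<Rightarrow> 'n::{finite,wellorder} mat) \<Rightarrow> (nat \<Rightarrow> real) \<Rightarrow> 'n mat \<Rightarrow> nat \<Rightarrow> 'n mat" where
  "benettin_V \<Phi> h V0 0 = V0"
| "benettin_V \<Phi> h V0 (Suc n) = fst (qr (\<Phi> (grid h n) (h (Suc n)) ** benettin_V \<Phi> h V0 n))"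

definition benettin_R ::
  "(real \<Rightarrow> real \<Rightarrow> 'n::{finite,wellorder} mat) \<Rightarrow> (nat \<Rightarrow> real) \<Rightarrow> 'n mat \<Rightarrow> nat \<Rightarrow> 'n mat" where
  "benettin_R \<Phi> h V0 n = snd (qr (\<Phi> (grid h (n - 1)) (h n) ** benettin_V \<Phi> h V0 (n - 1)))"

definition benettin_output ::
  "(real \<Rightarrow> real \<Rightarrow> 'n::{finite,wellorder} mat) \<Rightarrow> (nat \<Rightarrow> real) \<Rightarrow> 'n mat \<Rightarrow> nat \<Rightarrow> nat \<Rightarrow> real" where
  "benettin_output \<Phi> h V0 i n = (\<Sum>k=1..n. ln (benettin_R \<Phi> h V0 k $ idx i $ idx i)) / grid h n"

end

theory Submission
  imports Defs "HOL-Real_Asymp.Real_Asymp"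
begin

text \<open>
  For \<open>L = d\<^sub>1 + \<dots> + d\<^sub>l\<close> the sum of the first \<open>L\<close> outputs is the exponential rate of the \<open>L\<close>-volume
  \<open>\<parallel>\<Phi>\<^sub>n \<dots> \<Phi>\<^sub>1 w\<parallel>\<close> with \<open>w = v\<^sub>1 \<and> \<dots> \<and> v\<^sub>L\<close>. On the exterior power the Cauchy matrix has norm
  \<open>\<sigma>\<^sub>1 \<dots> \<sigma>\<^sub>L\<close>, and by regularity and a min-max argument this product has rate
  \<open>d\<^sub>1\<lambda>\<^sub>1 + \<dots> + d\<^sub>l\<lambda>\<^sub>l\<close>. Strong fast invertibility makes these norms multiplicative up to a
  constant. Hence for almost every \<open>w\<close> the solution through \<open>w\<close> grows like the norm, and the
  relative error caused by the local errors is bounded by a multiple of their sum. If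
  that sum is small, the computed volume is comparable to the norm, uniformly in \<open>n\<close>.
\<close>

section \<open>Tensor powers\<close>

text \<open>One \<open>\<epsilon>\<close> has to serve every sequence of stepsizes, so the
  exceptional null set must not depend on the stepsizes. It is taken from the exact flow alone: a
  generic wedge keeps a volume of at least \<open>\<eta>\<close> times the norm at all times, and
  \<open>\<epsilon>\<close> is chosen so that the numerical error stays below half of this. A
  Gronwall estimate of the error would bring in factors exponential in time. Instead each local
  error, which is proportional to the norm of the flow up to the step where it arises, is carried by
  the exact flow to a later time \<open>t\<close>. Multiplicativity of the norms up to a constant
  compares the result with the norm of the flow from 0 to \<open>t\<close>; no growth factor remains
  and the relative errors simply add up. Regularity enters because min-max only bounds the rates of
  the singular values from above. The determinant bounds the rate of their product from below by the
  sum of these upper bounds, which leaves no slack in any of them. Fast invertibility is assumed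
  only at the ends of the blocks, so the outputs are controlled through partial sums ending there; a
  block is the difference of two of them.\<close>

text \<open>
  The slots outside \<open>S\<close> carry the identity, so that a single index type serves the tensor powers of
  all orders \<open>card S\<close>. The exterior power of order \<open>card S\<close> is represented by the tensors that alternate
  in the slots of \<open>S\<close>.
\<close>

definition tensor_pow :: "'n::finite set \<Rightarrow> real^'n^'n \<Rightarrow> real^('n \<Rightarrow> 'n)^('n \<Rightarrow> 'n)" where
  "tensor_pow S M = (\<chi> f g. \<Prod>i\<in>UNIV. (if i \<in> S then M else mat 1) $ f i $ g i)"

text \<open>Distributivity turns a product over slots of row-by-column sums into one sum over all
  intermediate multi-indices. A slot outside \<open>S\<close> fits the same formula because the
  identity is its own square.\<close>

lemma tensor_pow_mult: "tensor_pow S (A ** B) = tensor_pow S A ** tensor_pow S B"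
proof -
  have "(\<Prod>i\<in>UNIV. (if i \<in> S then A ** B else mat 1) $ f i $ g i) =
      (\<Sum>h\<in>UNIV. (\<Prod>i\<in>UNIV. (if i \<in> S then A else mat 1) $ f i $ h i) *
                 (\<Prod>i\<in>UNIV. (if i \<in> S then B else mat 1) $ h i $ g i))" for f g :: "'a \<Rightarrow> 'a"
  proof -
    have "(if i \<in> S then A ** B else mat 1) $ f i $ g i =
        (\<Sum>a\<in>UNIV. (if i \<in> S then A else mat 1) $ f i $ a * (if i \<in> S then B else mat 1) $ a $ g i)" for i
    proof -
      have "(if i \<in> S then A ** B else mat 1) =
          (if i \<in> S then A else mat 1) ** (if i \<in> S then B else mat 1)"
        by simp
      then show ?thesis
        by (simp only: matrix_matrix_mult_def vec_lambda_beta)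
    qed
    then show ?thesis
      using prod_sum_PiE[of "UNIV :: 'a set" "\<lambda>_. UNIV :: 'a set"
          "\<lambda>i a. (if i \<in> S then A else mat 1) $ f i $ a * (if i \<in> S then B else mat 1) $ a $ g i"]
      by (simp add: prod.distrib PiE_UNIV_domain)
  qed
  then show ?thesis
    unfolding vec_eq_iff
    by (subst matrix_matrix_mult_def) (simp add: tensor_pow_def)
qed

lemma tensor_pow_transpose: "tensor_pow S (transpose A) = transpose (tensor_pow S A)"
proof -
  have "(if i \<in> S then transpose A else mat 1) $ a $ b = (if i \<in> S then A else mat 1) $ b $ a" for i a b
    by (auto simp: transpose_def mat_def)
  then show ?thesis
    by (simp add: tensor_pow_def vec_eq_iff) (simp add: transpose_def)
qed

lemma tensor_pow_diag:
  assumes "\<And>i j. i \<noteq> j \<Longrightarrow> D $ i $ j = 0"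
  shows "(tensor_pow S D *v T) $ f = (\<Prod>i\<in>S. D $ f i $ f i) * T $ f"
proof -
  have "tensor_pow S D $ f $ g = (if g = f then \<Prod>i\<in>S. D $ f i $ f i else 0)" for g
  proof (cases "g = f")
    case True
    have "(\<Prod>i\<in>UNIV. (if i \<in> S then D else mat 1) $ f i $ f i) =
        (\<Prod>i\<in>UNIV. if i \<in> S then D $ f i $ f i else 1)"
      by (rule prod.cong) (auto simp: mat_def)
    then show ?thesis
      using True by (simp add: tensor_pow_def prod.If_cases)
  next
    case False
    then obtain i where "f i \<noteq> g i" by force
    then have "(if i \<in> S then D else mat 1) $ f i $ g i = 0"
      using assms by (auto simp: mat_def)
    then have "(\<Prod>i\<in>UNIV. (if i \<in> S then D else mat 1) $ f i $ g i) = 0"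
      by (intro prod_zero bexI[of _ i]) auto
    then show ?thesis
      using False by (simp add: tensor_pow_def)
  qed
  then have "(tensor_pow S D *v T) $ f = (\<Sum>g\<in>UNIV. if g = f then (\<Prod>i\<in>S. D $ f i $ f i) * T $ g else 0)"
    unfolding matrix_vector_mult_def vec_lambda_beta by (intro sum.cong) simp_all
  then show ?thesis by (simp add: sum.delta)
qed

lemma tensor_pow_mat1: "tensor_pow S (mat 1) = mat 1"
  by (simp add: tensor_pow_def vec_eq_iff) (auto simp: mat_def fun_eq_iff)

lemma orthogonal_matrix_tensor_pow:
  "orthogonal_matrix A \<Longrightarrow> orthogonal_matrix (tensor_pow S A)"
  by (simp add: orthogonal_matrix tensor_pow_mat1 flip: tensor_pow_transpose tensor_pow_mult)

lemma norm_orthogonal_matrix_mult: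
  fixes Q :: "real^'n^'n"
  assumes "orthogonal_matrix Q"
  shows "norm (Q *v x) = norm x"
proof -
  have "(Q *v x) \<bullet> (Q *v x) = (transpose Q *v (Q *v x)) \<bullet> x"
    by (simp only: transpose_matrix_vector dot_lmul_matrix)
  also have "\<dots> = x \<bullet> x"
    using assms by (simp add: matrix_vector_mul_assoc orthogonal_matrix_def)
  finally show ?thesis by (simp add: norm_eq)
qed

section \<open>Alternating tensors and wedges of columns\<close>

definition alternating :: "'n::finite set \<Rightarrow> real^('n \<Rightarrow> 'n) \<Rightarrow> bool" where
  "alternating S T \<longleftrightarrow> (\<forall>\<pi> f. \<pi> permutes S \<longrightarrow> T $ (f \<circ> \<pi>) = of_int (sign \<pi>) * T $ f)"

text \<open>A permutation of \<open>S\<close> moves slots carrying \<open>M\<close> among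
  themselves, so permuting row and column index simultaneously only reorders the factors of an
  entry. Reindexing the sum by the permutation then pulls out the sign.\<close>

lemma alternating_tensor_pow:
  assumes "alternating S T"
  shows "alternating S (tensor_pow S M *v T)"
  unfolding alternating_def
proof (intro allI impI)
  fix \<pi> f assume p: "\<pi> permutes (S :: 'a set)"
  have bij: "bij_betw (\<lambda>g. g \<circ> \<pi>) UNIV UNIV"
    by (rule bij_betwI[of _ _ _ "\<lambda>g. g \<circ> inv \<pi>"])
      (auto simp: comp_assoc permutes_inv_o[OF p])
  have K: "tensor_pow S M $ (f \<circ> \<pi>) $ (g \<circ> \<pi>) = tensor_pow S M $ f $ g" for g
  proof -
    have "(\<Prod>i\<in>UNIV. (if i \<in> S then M else mat 1) $ f (\<pi> i) $ g (\<pi> i)) =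
        (\<Prod>i\<in>UNIV. (if \<pi> i \<in> S then M else mat 1) $ f (\<pi> i) $ g (\<pi> i))"
      by (simp add: permutes_in_image[OF p])
    also have "\<dots> = (\<Prod>i\<in>UNIV. (if i \<in> S then M else mat 1) $ f i $ g i)"
      using permutes_bij[OF p] by (intro prod.reindex_bij_betw)
    finally show ?thesis
      by (simp add: tensor_pow_def)
  qed
  have "(tensor_pow S M *v T) $ (f \<circ> \<pi>) = (\<Sum>g\<in>UNIV. tensor_pow S M $ (f \<circ> \<pi>) $ g * T $ g)"
    by (simp add: matrix_vector_mult_def)
  also have "\<dots> = (\<Sum>g\<in>UNIV. tensor_pow S M $ (f \<circ> \<pi>) $ (g \<circ> \<pi>) * T $ (g \<circ> \<pi>))"
    using sum.reindex_bij_betw[OF bij, of "\<lambda>g. tensor_pow S M $ (f \<circ> \<pi>) $ g * T $ g"] by simp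
  also have "\<dots> = (\<Sum>g\<in>UNIV. of_int (sign \<pi>) * (tensor_pow S M $ f $ g * T $ g))"
    using assms p by (simp only: K) (simp add: alternating_def mult_ac)
  also have "\<dots> = of_int (sign \<pi>) * (tensor_pow S M *v T) $ f"
    by (simp add: matrix_vector_mult_def sum_distrib_left)
  finally show "(tensor_pow S M *v T) $ (f \<circ> \<pi>) = of_int (sign \<pi>) * (tensor_pow S M *v T) $ f" .
qed

text \<open>Swapping two slots with equal entries leaves the multi-index unchanged but reverses the
  sign.\<close>

lemma alternating_inj_on:
  assumes "alternating S T" "T $ f \<noteq> 0"
  shows "inj_on f S"
proof (rule inj_onI, rule ccontr)
  fix a b assume ab: "a \<in> S" "b \<in> S" "f a = f b" "a \<noteq> b"
  have "f \<circ> Transposition.transpose a b = f"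
    using ab by (auto simp: fun_eq_iff Transposition.transpose_def)
  moreover have "T $ (f \<circ> Transposition.transpose a b) = of_int (sign (Transposition.transpose a b)) * T $ f"
    using assms(1) permutes_swap_id[OF ab(1,2)] by (simp add: alternating_def)
  ultimately show False
    using assms(2) ab by (simp add: sign_swap_id)
qed

text \<open>The antisymmetrized, not normalized product of the basis vectors with labels in
  \<open>S\<close>; a slot outside \<open>S\<close> is frozen at its own label. Applying
  \<open>tensor_pow S V\<close> to it gives the wedge of the columns of \<open>V\<close> with labels
  in \<open>S\<close>.\<close>

definition wedge_basis :: "'n::finite set \<Rightarrow> real^('n \<Rightarrow> 'n)" where
  "wedge_basis S = (\<chi> f. if f permutes S then of_int (sign f) else 0)"

lemma alternating_wedge_basis: "alternating (S :: 'n::finite set) (wedge_basis S)"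
  unfolding alternating_def
proof (intro allI impI)
  fix \<pi> and f :: "'n \<Rightarrow> 'n" assume p: "\<pi> permutes S"
  have perm: "permutation g" if "g permutes S" for g
    using that by (auto simp: permutation_permutes)
  show "wedge_basis S $ (f \<circ> \<pi>) = of_int (sign \<pi>) * wedge_basis S $ f"
  proof (cases "f permutes S")
    case True
    then show ?thesis
      using p permutes_compose[OF p True]
      by (simp add: wedge_basis_def sign_compose perm)
  next
    case False
    have "\<not> f \<circ> \<pi> permutes S"
    proof
      assume "f \<circ> \<pi> permutes S"
      then have "(f \<circ> \<pi>) \<circ> inv \<pi> permutes S"
        using permutes_compose[OF permutes_inv[OF p]] by blast
      then show False
        using False by (simp add: comp_assoc permutes_inv_o[OF p])
    qed
    then show ?thesis
      using False by (simp add: wedge_basis_def)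
  qed
qed

lemma wedge_basis_nonzero: "wedge_basis S \<noteq> 0"
proof
  assume "wedge_basis S = 0"
  then have "wedge_basis S $ id = 0" by simp
  then show False by (simp add: wedge_basis_def permutes_id)
qed

text \<open>An upper triangular matrix preserves the span of the basis vectors of an initial segment
  and so acts on their wedge by the determinant of that block.\<close>

lemma tensor_pow_triangular:
  fixes S :: "'n::{finite,wellorder} set"
  assumes R: "\<And>i j. j < i \<Longrightarrow> R $ i $ j = 0" and S: "\<And>i j. i \<in> S \<Longrightarrow> j \<le> i \<Longrightarrow> j \<in> S"
  shows "tensor_pow S R *v wedge_basis S = (\<Prod>i\<in>S. R $ i $ i) *s wedge_basis S"
proof -
  let ?T = "tensor_pow S R *v wedge_basis S"
  \<comment> \<open>A nonzero entry in row \<open>f\<close> and column \<open>g\<close> forces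
    \<open>f i = i\<close> outside \<open>S\<close> and, by triangularity,
    \<open>f i \<le> g i\<close> inside. Then \<open>f\<close> permutes \<open>S\<close>, and
    \<open>f \<circ> inv g\<close> is a permutation that never increases an index, hence the
    identity.\<close>
  have term0: "tensor_pow S R $ f $ g = 0" if "g permutes S" "\<not> (f permutes S \<and> g = f)" "inj_on f S" for f g
  proof (rule ccontr)
    assume nz: "tensor_pow S R $ f $ g \<noteq> 0"
    then have nz': "(if i \<in> S then R else mat 1) $ f i $ g i \<noteq> 0" for i
      by (auto simp: tensor_pow_def)
    have fi: "f i = i" if "i \<notin> S" for i
    proof -
      have "g i = i" using that \<open>g permutes S\<close> by (simp add: permutes_not_in)
      then show ?thesis using nz'[of i] that by (auto simp: mat_def split: if_splits)
    qed
    have le: "f i \<le> g i" if "i \<in> S" for i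
      using nz'[of i] that R[of "g i" "f i"] by (auto simp: not_less[symmetric])
    have "f ` S \<subseteq> S"
      using le S \<open>g permutes S\<close> by (metis image_subsetI permutes_in_image)
    then have "f ` S = S"
      by (rule endo_inj_surj[OF finite _ \<open>inj_on f S\<close>])
    then have fp: "f permutes S"
      using fi \<open>inj_on f S\<close> by (intro bij_imp_permutes) (auto simp: bij_betw_def)
    have "f \<circ> inv g permutes S"
      using fp permutes_compose permutes_inv that(1) by blast
    moreover have "\<forall>i\<in>S. (f \<circ> inv g) i \<le> i"
    proof
      fix i assume "i \<in> S"
      then have "inv g i \<in> S" using that(1) by (metis permutes_in_image permutes_inv)
      from le[OF this] show "(f \<circ> inv g) i \<le> i"
        by (simp add: permutes_inverses[OF that(1)])
    qed
    ultimately have "f \<circ> inv g = id" by (rule permutes_natset_le)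
    then have "f = g"
      by (metis comp_assoc comp_id id_comp permutes_inv_o(2) that(1))
    then show False using fp that by simp
  qed
  have "?T $ f = (\<Prod>i\<in>S. R $ i $ i) * wedge_basis S $ f" for f
  proof (cases "f permutes S")
    case True
    have "tensor_pow S R $ f $ f = (\<Prod>i\<in>S. R $ f i $ f i)"
    proof -
      have "(\<Prod>i\<in>UNIV. (if i \<in> S then R else mat 1) $ f i $ f i) =
          (\<Prod>i\<in>UNIV. if i \<in> S then R $ f i $ f i else 1)"
        by (rule prod.cong) (auto simp: mat_def)
      then show ?thesis by (simp add: tensor_pow_def prod.If_cases)
    qed
    also have "\<dots> = (\<Prod>i\<in>S. R $ i $ i)"
      using permutes_imp_bij[OF True] by (rule prod.reindex_bij_betw)
    finally have d: "tensor_pow S R $ f $ f = (\<Prod>i\<in>S. R $ i $ i)" .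
    have "?T $ f = (\<Sum>g\<in>UNIV. if g = f then tensor_pow S R $ f $ f * wedge_basis S $ f else 0)"
      unfolding matrix_vector_mult_def vec_lambda_beta
    proof (rule sum.cong[OF refl])
      fix g
      show "tensor_pow S R $ f $ g * wedge_basis S $ g =
          (if g = f then tensor_pow S R $ f $ f * wedge_basis S $ f else 0)"
        using term0[of g f] permutes_inj_on[OF True] by (auto simp: wedge_basis_def)
    qed
    then show ?thesis by (simp add: sum.delta d)
  next
    case False
    \<comment> \<open>For a non-injective \<open>f\<close> the single terms may be nonzero; their
      sum vanishes because the image is again alternating.\<close>
    have "?T $ f = 0"
    proof (cases "inj_on f S")
      case True
      have "tensor_pow S R $ f $ g * wedge_basis S $ g = 0" for g
        using term0[of g f] True False by (auto simp: wedge_basis_def)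
      then show ?thesis by (simp only: matrix_vector_mult_def vec_lambda_beta sum.neutral_const)
    next
      case False
      then show ?thesis
        using alternating_inj_on[OF alternating_tensor_pow[OF alternating_wedge_basis]] by blast
    qed
    then show ?thesis using False by (simp add: wedge_basis_def)
  qed
  then show ?thesis by (simp add: vec_eq_iff)
qed

lemma prod_initial_segment_ge:
  fixes s :: "'n::{finite,linorder} \<Rightarrow> real"
  assumes s: "\<And>i. 0 \<le> s i" "\<And>i j. i \<le> j \<Longrightarrow> s j \<le> s i"
    and S: "\<And>i j. i \<in> S \<Longrightarrow> j \<le> i \<Longrightarrow> j \<in> S" and f: "inj_on f S"
  shows "(\<Prod>i\<in>S. s (f i)) \<le> (\<Prod>i\<in>S. s i)"
proof -
  let ?T = "f ` S"
  have fin: "finite S" "finite ?T" by auto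
  have card: "card (?T - S) = card (S - ?T)"
    using card_image[OF f] card_Diff_subset_Int[of ?T S] card_Diff_subset_Int[of S ?T]
    by (simp add: Int_commute)
  then obtain b where b: "bij_betw b (?T - S) (S - ?T)"
    using finite_same_card_bij[of "?T - S" "S - ?T"] by auto
  have "(\<Prod>i\<in>S. s (f i)) = (\<Prod>i\<in>?T. s i)"
    by (simp add: prod.reindex[OF f])
  also have "\<dots> = (\<Prod>i\<in>?T \<inter> S. s i) * (\<Prod>i\<in>?T - S. s i)"
    by (rule prod.Int_Diff) simp
  also have "\<dots> \<le> (\<Prod>i\<in>?T \<inter> S. s i) * (\<Prod>i\<in>?T - S. s (b i))"
  proof (intro mult_left_mono prod_mono conjI)
    fix i assume i: "i \<in> ?T - S"
    then have "b i \<in> S" using b by (auto simp: bij_betw_def)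
    then have "b i \<le> i" using S[of "b i" i] i by (meson DiffD2 linear)
    then show "s i \<le> s (b i)" by (rule s(2))
  qed (auto intro: s prod_nonneg)
  also have "(\<Prod>i\<in>?T - S. s (b i)) = (\<Prod>i\<in>S - ?T. s i)"
    using b by (rule prod.reindex_bij_betw)
  also have "(\<Prod>i\<in>?T \<inter> S. s i) * (\<Prod>i\<in>S - ?T. s i) = (\<Prod>i\<in>S. s i)"
    using prod.Int_Diff[of S s ?T] by (simp add: Int_commute)
  finally show ?thesis .
qed

section \<open>Singular values and QR decompositions\<close>

text \<open>This rule rewrites \<open>transpose A *v x\<close> into \<open>x v* A\<close>, a form
  that the facts about \<open>*v\<close> below do not match.\<close>

declare transpose_matrix_vector [simp del]

text \<open>One step of the greedy construction of right singular vectors. Fewer than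
  \<open>CARD('n)\<close> indices precede \<open>x\<close>, so some unit vector is orthogonal to all
  \<open>f i\<close> with \<open>i < x\<close>, and compactness yields a maximizer. The family
  \<open>f\<close> is arbitrary so that the lemma can serve as the step of a well-founded
  recursion.\<close>

lemma exists_orthogonal_unit_maximizer:
  fixes M :: "'n::{finite,wellorder} mat" and f :: "'n \<Rightarrow> (real, 'n) vec"
  shows "\<exists>r. norm r = 1 \<and> (\<forall>i<x. r \<bullet> f i = 0) \<and>
    (\<forall>u. norm u = 1 \<longrightarrow> (\<forall>i<x. u \<bullet> f i = 0) \<longrightarrow> norm (M *v u) \<le> norm (M *v r))"
proof -
  let ?W = "{u. \<forall>i<x. u \<bullet> f i = 0}"
  have "dim (f ` {..<x}) < DIM((real, 'n) vec)"
  proof -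
    have "dim (f ` {..<x}) \<le> card (f ` {..<x})" by (rule dim_le_card') simp
    also have "\<dots> \<le> card {..<x}" by (rule card_image_le) simp
    also have "\<dots> < CARD('n)" by (rule psubset_card_mono) auto
    finally show ?thesis by simp
  qed
  then obtain y where y: "y \<noteq> 0" "\<And>z. z \<in> span (f ` {..<x}) \<Longrightarrow> orthogonal y z"
    using orthogonal_to_subspace_exists by blast
  then have "y \<in> ?W" by (auto simp: orthogonal_def span_base)
  then have "(1 / norm y) *\<^sub>R y \<in> sphere 0 1 \<inter> ?W" using y by simp
  then have ne: "sphere 0 1 \<inter> ?W \<noteq> {}" by blast
  have "closed ?W"
  proof -
    have "?W = (\<Inter>i\<in>{..<x}. {u. u \<bullet> f i = 0})" by auto
    then show ?thesis
      by (auto intro!: closed_INT closed_Collect_eq continuous_intros)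
  qed
  then have comp: "compact (sphere 0 1 \<inter> ?W)"
    by (intro compact_Int_closed compact_sphere)
  have "continuous_on (sphere 0 1 \<inter> ?W) (\<lambda>u. norm (M *v u))"
    by (intro continuous_intros linear_continuous_on) (simp add: matrix_vector_mul_bounded_linear)
  from continuous_attains_sup[OF comp ne this]
  obtain r where "r \<in> sphere 0 1 \<inter> ?W"
      "\<And>u. u \<in> sphere 0 1 \<inter> ?W \<Longrightarrow> norm (M *v u) \<le> norm (M *v r)"
    by blast
  then show ?thesis by auto
qed

text \<open>Varying a maximizer \<open>v\<close> of the norm in an orthogonal direction \<open>u\<close> leaves the maximum
  stationary, which forces \<open>M v\<close> and \<open>M u\<close> to be orthogonal.\<close>

lemma maximizer_orthogonal_images:
  fixes M :: "real^'n^'m"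
  assumes max: "\<And>t. norm (M *v (v + t *\<^sub>R u)) \<le> norm (M *v v) * norm (v + t *\<^sub>R u)"
    and v: "norm v = 1" "v \<bullet> u = 0"
  shows "(M *v v) \<bullet> (M *v u) = 0"
proof (rule ccontr)
  define b where "b = (M *v v) \<bullet> (M *v u)"
  define K where "K = (norm (M *v v))\<^sup>2 * (norm u)\<^sup>2"
  assume "(M *v v) \<bullet> (M *v u) \<noteq> 0"
  then have b: "b \<noteq> 0" by (simp add: b_def)
  have K: "K \<ge> 0" by (simp add: K_def)
  have *: "2 * t * b \<le> t\<^sup>2 * K" for t
  proof -
    have e1: "(norm (M *v (v + t *\<^sub>R u)))\<^sup>2 = (norm (M *v v))\<^sup>2 + 2 * t * b + t\<^sup>2 * (norm (M *v u))\<^sup>2"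
      unfolding power2_norm_eq_inner b_def
      by (simp add: matrix_vector_right_distrib matrix_vector_mult_scaleR inner_add inner_commute
          algebra_simps power2_eq_square)
    have e2: "(norm (v + t *\<^sub>R u))\<^sup>2 = 1 + t\<^sup>2 * (norm u)\<^sup>2"
      using v unfolding power2_norm_eq_inner norm_eq_1
      by (simp add: inner_add inner_commute algebra_simps power2_eq_square)
    have "(norm (M *v (v + t *\<^sub>R u)))\<^sup>2 \<le> (norm (M *v v) * norm (v + t *\<^sub>R u))\<^sup>2"
      using max by (intro power_mono) auto
    then have "2 * t * b + t\<^sup>2 * (norm (M *v u))\<^sup>2 \<le> t\<^sup>2 * K"
      unfolding power_mult_distrib e1 e2 K_def by (simp add: algebra_simps)
    moreover have "0 \<le> t\<^sup>2 * (norm (M *v u))\<^sup>2" by simp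
    ultimately show ?thesis by linarith
  qed
  \<comment> \<open>At \<open>t = b / c\<close> the inequality becomes
    \<open>2 * b\<^sup>2 * c \<le> b\<^sup>2 * K\<close> after clearing denominators, which is false
    for \<open>c = K + 1\<close>. The added 1 keeps \<open>c\<close> positive when \<open>K\<close>
    is 0.\<close>
  define c where "c = K + 1"
  have c: "c > 0" using K by (simp add: c_def)
  have "2 * (b / c) * b * c\<^sup>2 \<le> (b / c)\<^sup>2 * K * c\<^sup>2"
    using *[of "b / c"] by (rule mult_right_mono) simp
  moreover have "2 * (b / c) * b * c\<^sup>2 = 2 * b\<^sup>2 * c" "(b / c)\<^sup>2 * K * c\<^sup>2 = b\<^sup>2 * K"
    using c by (simp_all add: field_simps power2_eq_square)
  ultimately have "2 * b\<^sup>2 * (K + 1) \<le> b\<^sup>2 * K"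
    by (simp only: c_def)
  moreover have "b\<^sup>2 * K < 2 * b\<^sup>2 * (K + 1)"
  proof -
    have "0 < b\<^sup>2 * (K + 2)" using b K by simp
    then show ?thesis by (simp add: algebra_simps)
  qed
  ultimately show False by linarith
qed

abbreviation diag :: "real^'n \<Rightarrow> real^'n^'n" where
  "diag s \<equiv> (\<chi> i j. if i = j then s $ i else 0)"

definition is_svd :: "'n::{finite,wellorder} mat \<Rightarrow> 'n mat \<Rightarrow> (real, 'n) vec \<Rightarrow> 'n mat \<Rightarrow> bool" where
  "is_svd M U s V \<longleftrightarrow> (\<forall>i. 0 \<le> s $ i) \<and> (\<forall>i j. i \<le> j \<longrightarrow> s $ j \<le> s $ i) \<and>
     orthogonal_matrix U \<and> orthogonal_matrix V \<and> M = U ** diag s ** transpose V"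

lemma matrix_mult_diag: "(U ** diag s) $ i $ j = U $ i $ j * s $ j"
  by (simp add: matrix_matrix_mult_def if_distrib[of "\<lambda>x. _ * x"] sum.delta cong: if_cong)

lemma orthogonal_matrix_cancel:
  fixes A Q :: "real^'n^'n"
  assumes "orthogonal_matrix Q"
  shows "A ** transpose Q ** Q = A" "A ** Q ** transpose Q = A"
  using assms by (simp_all add: orthogonal_matrix_def flip: matrix_mul_assoc)

text \<open>The right singular vectors are chosen greedily, each maximizing the norm of its image
  among unit vectors orthogonal to its predecessors. Their images are orthogonal, and nonzero by
  invertibility; normalized, they are the left singular vectors, and their lengths are the singular
  values.\<close>

lemma svd_exists:
  fixes M :: "'n::{finite,wellorder} mat"
  assumes "invertible M"
  shows "\<exists>U s V. is_svd M U s V"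
proof -
  let ?P = "\<lambda>f (x :: 'n) r. norm r = 1 \<and> (\<forall>i<x. r \<bullet> f i = 0) \<and>
    (\<forall>u. norm u = 1 \<longrightarrow> (\<forall>i<x. u \<bullet> f i = 0) \<longrightarrow> norm (M *v u) \<le> norm (M *v r))"
  \<comment> \<open>\<open>?P\<close> consults \<open>f\<close> only below \<open>x\<close>, so
    choice along the well-order applies.\<close>
  have "\<exists>f. \<forall>x. ?P f x (f x)"
  proof (rule dependent_wf_choice[OF wf, where P = ?P])
    show "?P f x r = ?P g x r" if "\<And>z. (z, x) \<in> {(x, y). x < y} \<Longrightarrow> f z = g z"
      for f g :: "'n \<Rightarrow> (real, 'n) vec" and x r
      using that by auto
    show "\<exists>r. ?P f x r" for f x
      by (rule exists_orthogonal_unit_maximizer)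
  qed
  then obtain v where "\<forall>x. ?P v x (v x)" by blast
  then have P: "?P v x (v x)" for x by (rule spec)
  have v: "norm (v x) = 1" "i < x \<Longrightarrow> v x \<bullet> v i = 0" for x i
    using P[of x] by simp_all
  have max1: "norm (M *v u) \<le> norm (M *v v x)" if "norm u = 1" "\<And>i. i < x \<Longrightarrow> u \<bullet> v i = 0" for x u
    using P[of x] that by simp
  have max: "norm (M *v w) \<le> norm (M *v v x) * norm w" if "\<And>i. i < x \<Longrightarrow> w \<bullet> v i = 0" for w x
  proof (cases "w = 0")
    case False
    have "norm (M *v ((1 / norm w) *\<^sub>R w)) \<le> norm (M *v v x)"
      by (rule max1) (use False that in auto)
    then show ?thesis
      using False by (simp add: matrix_vector_mult_scaleR field_simps)
  qed simp
  have v_orth: "v i \<bullet> v j = 0" if "i \<noteq> j" for i j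
    using v(2)[of i j] v(2)[of j i] that by (auto simp: inner_commute neq_iff)
  \<comment> \<open>For \<open>i < j\<close> the perturbed vector
    \<open>v i + t *\<^sub>R v j\<close> is still orthogonal to all predecessors of
    \<open>v i\<close> and thus competes with \<open>v i\<close> for the maximum.\<close>
  have Mv_lt: "(M *v v i) \<bullet> (M *v v j) = 0" if "i < j" for i j
  proof (rule maximizer_orthogonal_images)
    fix t
    show "norm (M *v (v i + t *\<^sub>R v j)) \<le> norm (M *v v i) * norm (v i + t *\<^sub>R v j)"
      using that by (intro max) (auto simp: inner_add v(2))
  qed (use that v_orth v in auto)
  have Mv_orth: "(M *v v i) \<bullet> (M *v v j) = 0" if "i \<noteq> j" for i j
    using Mv_lt[of i j] Mv_lt[of j i] that by (auto simp: inner_commute neq_iff)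
  have Mv_pos: "norm (M *v v i) > 0" for i
    using v(1)[of i] assms matrix_left_invertible_ker[of M] by (auto simp: invertible_left_inverse)
  define s where "s = (\<chi> i. norm (M *v v i))"
  define V where "V = (\<chi> a i. v i $ a)"
  define U where "U = (\<chi> a i. (M *v v i) $ a / s $ i)"
  have colV: "column i V = v i" for i
    by (simp add: column_def V_def vec_eq_iff)
  have colU: "column i U = (1 / s $ i) *\<^sub>R (M *v v i)" for i
    by (simp add: column_def U_def vec_eq_iff)
  have V: "orthogonal_matrix V"
    unfolding orthogonal_matrix_orthonormal_columns colV orthogonal_def using v v_orth by blast
  have U: "orthogonal_matrix U"
    unfolding orthogonal_matrix_orthonormal_columns colU orthogonal_def
    using Mv_pos by (auto simp: Mv_orth s_def)
  have "M ** V = U ** diag s"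
  proof -
    have "(M ** V) $ a $ i = U $ a $ i * s $ i" for a i
      using Mv_pos[of i] by (simp add: U_def V_def s_def matrix_matrix_mult_def matrix_vector_mult_def)
    then show ?thesis by (simp add: vec_eq_iff matrix_mult_diag)
  qed
  then have "M = U ** diag s ** transpose V"
    by (metis orthogonal_matrix_cancel(2) V)
  moreover have "s $ j \<le> s $ i" if "i \<le> j" for i j
    using max1[of "v j" i] v that by (auto simp: s_def)
  moreover have "0 \<le> s $ i" for i by (simp add: s_def)
  ultimately show ?thesis
    using U V unfolding is_svd_def by blast
qed

lemma singular_values_svd:
  assumes "invertible M"
  obtains U V where "is_svd M U (singular_values M) V"
proof -
  have "\<exists>s. (\<forall>i. 0 \<le> s $ i) \<and> (\<forall>i j. i \<le> j \<longrightarrow> s $ j \<le> s $ i) \<and>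
     (\<exists>U V. orthogonal_matrix U \<and> orthogonal_matrix V \<and> M = U ** diag s ** transpose V)"
    using svd_exists[OF assms] unfolding is_svd_def by blast
  from someI_ex[OF this] that show ?thesis
    unfolding singular_values_def[symmetric] is_svd_def by blast
qed

lemma abs_det_singular_values:
  assumes "invertible M"
  shows "\<bar>det M\<bar> = (\<Prod>i\<in>UNIV. singular_values M $ i)"
proof -
  define s where "s = singular_values M"
  obtain U V where "is_svd M U s V"
    using singular_values_svd[OF assms] unfolding s_def .
  then have s: "\<And>i. 0 \<le> s $ i"
    and U: "orthogonal_matrix U" and V: "orthogonal_matrix V" and M: "M = U ** diag s ** transpose V"
    unfolding is_svd_def by blast+
  have "\<bar>det U\<bar> = 1" "\<bar>det V\<bar> = 1"
    using det_orthogonal_matrix[OF U] det_orthogonal_matrix[OF V] by auto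
  moreover have "det (diag s) = (\<Prod>i\<in>UNIV. s $ i)"
    by (subst det_diagonal) auto
  moreover have "0 \<le> (\<Prod>i\<in>UNIV. s $ i)"
    using s by (intro prod_nonneg) auto
  ultimately have "\<bar>det (U ** diag s ** transpose V)\<bar> = (\<Prod>i\<in>UNIV. s $ i)"
    by (simp add: det_mul abs_mult)
  then show ?thesis
    by (simp only: M[symmetric]) (simp only: s_def)
qed

lemma singular_values_pos:
  assumes "invertible M"
  shows "0 < singular_values M $ i"
proof -
  have "(\<Prod>i\<in>UNIV. singular_values M $ i) \<noteq> 0"
    unfolding abs_det_singular_values[OF assms, symmetric] using assms by (simp add: invertible_det_nz)
  then have "singular_values M $ i \<noteq> 0"
    by (simp only: prod_zero_iff[OF finite]) blast
  moreover obtain U V where "is_svd M U (singular_values M) V"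
    using singular_values_svd[OF assms] .
  then have "0 \<le> singular_values M $ i"
    unfolding is_svd_def by blast
  ultimately show ?thesis by simp
qed

text \<open>The half of Courant-Fischer that bounds a singular value from above: by dimension,
  \<open>E\<close> meets the span of the right singular vectors up to \<open>i\<close> nontrivially,
  and on that span \<open>M\<close> stretches by at least the singular value at \<open>i\<close>.
  The number \<open>card {..i}\<close> is the position of \<open>i\<close> counted from 1.\<close>

lemma singular_value_le_norm_on_subspace:
  fixes M :: "'n::{finite,wellorder} mat"
  assumes "invertible M" "subspace E" "dim E + card {..i} > CARD('n)"
  shows "\<exists>x\<in>E. x \<noteq> 0 \<and> singular_values M $ i * norm x \<le> norm (M *v x)"
proof -
  define s where "s = singular_values M"
  obtain U V where "is_svd M U s V"
    using singular_values_svd[OF assms(1)] unfolding s_def .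
  then have s: "\<And>i. 0 \<le> s $ i" "\<And>i j. i \<le> j \<Longrightarrow> s $ j \<le> s $ i"
    and U: "orthogonal_matrix U" and V: "orthogonal_matrix V" and M: "M = U ** diag s ** transpose V"
    by (auto simp: is_svd_def)
  \<comment> \<open>\<open>C\<close> is the span of the leading right singular vectors in the
    coordinates given by \<open>transpose V\<close>.\<close>
  define C where "C = {c :: (real, 'n) vec. \<forall>j. j \<notin> {..i} \<longrightarrow> c $ j = 0}"
  have C: "subspace C" "dim C = card {..i}"
    unfolding C_def using dim_substandard_cart[where d = "{..i}" and 'a = real and 'n = 'n]
    by (auto simp: subspace_def dim_vec_eq)
  have inj: "inj ((*v) (transpose V))"
    by (rule injI) (metis V matrix_vector_mul_assoc matrix_vector_mul_lid orthogonal_matrix_def)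
  let ?E = "(*v) (transpose V) ` E"
  have E: "subspace ?E" "dim ?E = dim E"
    using linear_subspace_image[OF matrix_vector_mul_linear assms(2)]
      dim_image_eq[OF matrix_vector_mul_linear inj_on_subset[OF inj subset_UNIV]] by blast+
  have "dim {x + y |x y. x \<in> ?E \<and> y \<in> C} \<le> CARD('n)"
    using dim_subset_UNIV[of "{x + y |x y. x \<in> ?E \<and> y \<in> C}"] by simp
  then have "dim (?E \<inter> C) > 0"
    using dim_sums_Int[OF E(1) C(1)] E C assms(3) by linarith
  then have "\<not> ?E \<inter> C \<subseteq> {0}" by (metis dim_eq_0 less_numeral_extra(3))
  then obtain x where x: "x \<in> E" "transpose V *v x \<in> C" "transpose V *v x \<noteq> 0" by auto
  let ?c = "transpose V *v x"
  have nx: "norm ?c = norm x"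
    by (simp add: V norm_orthogonal_matrix_mult)
  have "norm (M *v x) = norm (diag s *v ?c)"
    unfolding M by (simp add: U norm_orthogonal_matrix_mult flip: matrix_vector_mul_assoc)
  moreover have "norm (s $ i *\<^sub>R ?c) \<le> norm (diag s *v ?c)"
  proof (rule norm_le_componentwise_cart)
    fix j
    have "(diag s *v ?c) $ j = s $ j * ?c $ j"
      by (simp add: matrix_vector_mult_def if_distrib[of "\<lambda>x. x * _"] sum.delta' cong: if_cong)
    moreover have "s $ i * \<bar>?c $ j\<bar> \<le> s $ j * \<bar>?c $ j\<bar>"
      using x(2) s(2)[of j i] by (cases "j \<le> i") (auto simp: C_def intro: mult_right_mono)
    ultimately show "norm ((s $ i *\<^sub>R ?c) $ j) \<le> norm ((diag s *v ?c) $ j)"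
      using s(1) by (simp add: abs_mult)
  qed
  ultimately have "s $ i * norm x \<le> norm (M *v x)"
    using s(1) nx by simp
  then show ?thesis
    using x unfolding s_def by (intro bexI[of _ x]) auto
qed

section \<open>Operator norms on exterior powers\<close>

definition initial_segment :: "'n::linorder set \<Rightarrow> bool" where
  "initial_segment S \<longleftrightarrow> (\<forall>i\<in>S. \<forall>j\<le>i. j \<in> S)"

text \<open>For an initial segment \<open>S\<close> this is the operator norm of the exterior power.\<close>

definition gain :: "'n::{finite,wellorder} set \<Rightarrow> 'n mat \<Rightarrow> real" where
  "gain S M = (\<Prod>i\<in>S. singular_values M $ i)"

lemma gain_pos: "invertible M \<Longrightarrow> 0 < gain S M"
  by (auto simp: gain_def singular_values_pos intro: prod_pos)

lemma norm_tensor_pow_orthogonal: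
  "orthogonal_matrix Q \<Longrightarrow> norm (tensor_pow S Q *v T) = norm T"
  by (rule norm_orthogonal_matrix_mult[OF orthogonal_matrix_tensor_pow])

text \<open>The orthogonal factors preserve norms, so only the diagonal factor counts; it multiplies
  component \<open>f\<close> by the singular values at \<open>f i\<close>, \<open>i \<in> S\<close>.
  Alternation is decisive: components with repeated indices vanish, so no singular value is used
  twice and the leading ones give the largest factor.\<close>

lemma norm_tensor_pow_le_gain:
  assumes M: "invertible M" and S: "initial_segment S" and T: "alternating S T"
  shows "norm (tensor_pow S M *v T) \<le> gain S M * norm T"
proof -
  define s where "s = singular_values M"
  obtain U V where "is_svd M U s V"
    using singular_values_svd[OF M] unfolding s_def .
  then have s: "\<And>i. 0 \<le> s $ i" "\<And>i j. i \<le> j \<Longrightarrow> s $ j \<le> s $ i"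
    and U: "orthogonal_matrix U" and V: "orthogonal_matrix V" and M: "M = U ** diag s ** transpose V"
    by (auto simp: is_svd_def)
  let ?T = "tensor_pow S (transpose V) *v T"
  have "norm (tensor_pow S M *v T) = norm (tensor_pow S (diag s) *v ?T)"
    unfolding M by (simp add: tensor_pow_mult U norm_tensor_pow_orthogonal flip: matrix_vector_mul_assoc)
  also have "\<dots> \<le> norm (gain S M *\<^sub>R ?T)"
  proof (rule norm_le_componentwise_cart)
    fix f
    show "norm ((tensor_pow S (diag s) *v ?T) $ f) \<le> norm ((gain S M *\<^sub>R ?T) $ f)"
    proof (cases "?T $ f = 0")
      case False
      then have "inj_on f S"
        using alternating_inj_on alternating_tensor_pow T by blast
      then have "(\<Prod>i\<in>S. s $ f i) \<le> (\<Prod>i\<in>S. s $ i)"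
        using s S by (intro prod_initial_segment_ge) (auto simp: initial_segment_def)
      moreover have "0 \<le> (\<Prod>i\<in>S. s $ f i)" by (intro prod_nonneg s)
      ultimately show ?thesis
        by (simp add: tensor_pow_diag gain_def s_def abs_mult mult_right_mono)
    qed (simp add: tensor_pow_diag)
  qed
  also have "\<dots> = gain S M * norm T"
    using s V by (simp add: gain_def s_def norm_tensor_pow_orthogonal prod_nonneg)
  finally show ?thesis .
qed

text \<open>\<open>V\<close> is the right singular frame. The component at \<open>id\<close> is the
  coefficient along the singular direction of the exterior power that belongs to \<open>S\<close>,
  and this coefficient is multiplied by exactly the gain.\<close>

lemma gain_component_le_norm_tensor_pow:
  assumes "invertible M"
  shows "\<exists>V. orthogonal_matrix V \<and>
    (\<forall>T. gain S M * \<bar>(tensor_pow S (transpose V) *v T) $ id\<bar> \<le> norm (tensor_pow S M *v T))"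
proof -
  define s where "s = singular_values M"
  obtain U V where "is_svd M U s V"
    using singular_values_svd[OF assms] unfolding s_def .
  then have s: "\<And>i. 0 \<le> s $ i" 
    and U: "orthogonal_matrix U" and V: "orthogonal_matrix V" and M: "M = U ** diag s ** transpose V"
    by (auto simp: is_svd_def)
  have "gain S M * \<bar>(tensor_pow S (transpose V) *v T) $ id\<bar> \<le> norm (tensor_pow S M *v T)" for T
  proof -
    let ?T = "tensor_pow S (transpose V) *v T"
    have "gain S M * \<bar>?T $ id\<bar> = \<bar>(tensor_pow S (diag s) *v ?T) $ id\<bar>"
      using s by (simp add: tensor_pow_diag gain_def s_def abs_mult prod_nonneg)
    also have "\<dots> \<le> norm (tensor_pow S (diag s) *v ?T)"
      by (rule component_le_norm_cart)
    also have "\<dots> = norm (tensor_pow S M *v T)"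
      unfolding M by (simp add: tensor_pow_mult U norm_tensor_pow_orthogonal flip: matrix_vector_mul_assoc)
    finally show ?thesis .
  qed
  then show ?thesis using V by blast
qed

text \<open>The gain is attained at the wedge of the right singular vectors with labels in
  \<open>S\<close>: on \<open>wedge_basis S\<close> every contributing index permutes
  \<open>S\<close>, so the diagonal factor acts as a scalar.\<close>

lemma gain_le:
  assumes M: "invertible M"
    and le: "\<And>T. alternating S T \<Longrightarrow> norm (tensor_pow S M *v T) \<le> B * norm T"
  shows "gain S M \<le> B"
proof -
  define s where "s = singular_values M"
  obtain U V where "is_svd M U s V"
    using singular_values_svd[OF M] unfolding s_def .
  then have s: "\<And>i. 0 \<le> s $ i" 
    and U: "orthogonal_matrix U" and V: "orthogonal_matrix V" and M: "M = U ** diag s ** transpose V"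
    by (auto simp: is_svd_def)
  let ?w = "wedge_basis S" and ?T = "tensor_pow S V *v wedge_basis S"
  have "tensor_pow S (diag s) *v ?w = gain S M *\<^sub>R ?w"
  proof -
    have "(tensor_pow S (diag s) *v ?w) $ f = gain S M * ?w $ f" for f
      by (simp add: tensor_pow_diag)
        (auto simp: wedge_basis_def gain_def s_def prod.reindex_bij_betw permutes_imp_bij)
    then show ?thesis by (simp add: vec_eq_iff)
  qed
  moreover have "M ** V = U ** diag s"
    unfolding M by (rule orthogonal_matrix_cancel(1)[OF V])
  then have "tensor_pow S M *v ?T = tensor_pow S U *v (tensor_pow S (diag s) *v ?w)"
    by (simp add: matrix_vector_mul_assoc flip: tensor_pow_mult)
  ultimately have "norm (tensor_pow S M *v ?T) = gain S M * norm ?w"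
    using s by (simp add: U norm_tensor_pow_orthogonal gain_def s_def prod_nonneg)
  moreover have "norm (tensor_pow S M *v ?T) \<le> B * norm ?w"
    using le[of ?T] by (simp add: V norm_tensor_pow_orthogonal alternating_tensor_pow alternating_wedge_basis)
  ultimately show ?thesis
    using wedge_basis_nonzero[of S] by simp
qed

lemma gain_mult_le:
  assumes A: "invertible A" and B: "invertible B" and S: "initial_segment S"
  shows "gain S (A ** B) \<le> gain S A * gain S B"
proof (rule gain_le)
  show "invertible (A ** B)" using A B by (rule invertible_mult)
  fix T assume T: "alternating S T"
  have "norm (tensor_pow S (A ** B) *v T) = norm (tensor_pow S A *v (tensor_pow S B *v T))"
    by (simp add: tensor_pow_mult matrix_vector_mul_assoc)
  also have "\<dots> \<le> gain S A * norm (tensor_pow S B *v T)"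
    by (intro norm_tensor_pow_le_gain A S alternating_tensor_pow T)
  also have "\<dots> \<le> gain S A * (gain S B * norm T)"
    by (intro mult_left_mono norm_tensor_pow_le_gain B S T less_imp_le[OF gain_pos[OF A]])
  finally show "norm (tensor_pow S (A ** B) *v T) \<le> gain S A * gain S B * norm T" by simp
qed

text \<open>Gram-Schmidt: \<open>c j\<close> is the normalized component of column \<open>j\<close>
  orthogonal to the preceding columns.\<close>

lemma qr_exists:
  fixes M :: "'n::{finite,wellorder} mat"
  assumes "invertible M"
  shows "\<exists>Q R. is_qr M Q R"
proof -
  define E where "E j = span ((\<lambda>i. column i M) ` {..<j})" for j
  have "\<exists>z. norm z = 1 \<and> z \<in> span ((\<lambda>i. column i M) ` {..j}) \<and> (\<forall>w\<in>E j. z \<bullet> w = 0) \<and> 0 < z \<bullet> column j M"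
    for j
  proof -
    obtain y z where y: "y \<in> E j" and z: "\<And>w. w \<in> E j \<Longrightarrow> orthogonal z w" and yz: "column j M = y + z"
      using orthogonal_subspace_decomp_exists[of "(\<lambda>i. column i M) ` {..<j}" "column j M"]
      unfolding E_def span_span by blast
    \<comment> \<open>The left inverse sends column \<open>i\<close> to the \<open>i\<close>-th
      basis vector, so coordinate \<open>j\<close> of its image vanishes on \<open>E j\<close> but
      equals 1 at column \<open>j\<close>. This shows that column \<open>j\<close> is independent of
      its predecessors.\<close>
    obtain N where N: "N ** M = mat 1"
      using assms by (auto simp: invertible_left_inverse)
    have Ncol: "N *v column i M = axis i 1" for i
      by (simp add: matrix_vector_mul_assoc N flip: matrix_vector_mult_basis)
    have "subspace {x. (N *v x) $ j = 0}"
      by (auto simp: subspace_def matrix_vector_right_distrib matrix_vector_mult_scaleR)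
    moreover have "(\<lambda>i. column i M) ` {..<j} \<subseteq> {x. (N *v x) $ j = 0}"
      by (auto simp: Ncol axis_def)
    ultimately have "E j \<subseteq> {x. (N *v x) $ j = 0}"
      unfolding E_def by (intro span_minimal)
    then have "column j M \<notin> E j"
      by (auto simp: Ncol)
    then have "z \<noteq> 0" using y yz by auto
    have "column j M \<in> span ((\<lambda>i. column i M) ` {..j})"
      by (auto intro: span_base)
    moreover have "E j \<subseteq> span ((\<lambda>i. column i M) ` {..j})"
      unfolding E_def by (intro span_mono) auto
    ultimately have "z \<in> span ((\<lambda>i. column i M) ` {..j})"
      using y yz span_diff by (metis add_diff_cancel_left' subsetD)
    moreover have "z \<bullet> column j M = z \<bullet> z"
      using z[OF y] by (simp add: yz inner_add orthogonal_def)
    ultimately show ?thesis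
      using \<open>z \<noteq> 0\<close> z by (intro exI[of _ "(1 / norm z) *\<^sub>R z"]) (auto simp: orthogonal_def intro: span_mul)
  qed
  then obtain c where c: "\<And>j. norm (c j) = 1" "\<And>j. c j \<in> span ((\<lambda>i. column i M) ` {..j})"
      "\<And>j w. w \<in> E j \<Longrightarrow> c j \<bullet> w = 0" "\<And>j. 0 < c j \<bullet> column j M"
    by metis
  have E: "c i \<in> E j" if "i < j" for i j
    using c(2)[of i] that unfolding E_def by (meson span_mono image_mono subsetD atMost_iff lessThan_iff order_le_less_trans subsetI)
  have orth: "c i \<bullet> c j = 0" if "i \<noteq> j" for i j
    using c(3)[OF E[of i j]] c(3)[OF E[of j i]] that by (auto simp: inner_commute neq_iff)
  define Q where "Q = (\<chi> a i. c i $ a)"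
  define R where "R = transpose Q ** M"
  have col: "column i Q = c i" for i
    by (simp add: Q_def column_def vec_eq_iff)
  have Q: "orthogonal_matrix Q"
    unfolding orthogonal_matrix_orthonormal_columns col orthogonal_def using c(1) orth by blast
  have R: "R $ i $ j = c i \<bullet> column j M" for i j
    by (simp add: R_def Q_def matrix_matrix_mult_def transpose_def column_def inner_vec_def)
  have "R $ i $ j = 0" if "j < i" for i j
    unfolding R E_def using that by (intro c(3)) (auto simp: E_def intro: span_base)
  moreover have "M = Q ** R"
    using Q by (simp add: R_def matrix_mul_assoc[of Q] orthogonal_matrix_def)
  ultimately have "is_qr M Q R"
    using Q c(4) R by (simp add: is_qr_def)
  then show ?thesis by blast
qed

lemma is_qr_qr: "invertible M \<Longrightarrow> is_qr M (fst (qr M)) (snd (qr M))"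
  unfolding qr_def using qr_exists[of M] someI[of "\<lambda>(Q, R). is_qr M Q R"]
  by (metis (mono_tags, lifting) case_prod_beta' case_prod_conv)

section \<open>Benettin's algorithm\<close>

lemma bij_betw_idx: "bij_betw (idx :: nat \<Rightarrow> 'n::{finite,wellorder}) {1..CARD('n)} UNIV"
proof -
  let ?xs = "sorted_list_of_set (UNIV :: 'n set)"
  have "bij_betw ((!) ?xs) {..<length ?xs} (set ?xs)"
    by (rule bij_betw_nth) auto
  then have 1: "bij_betw ((!) ?xs) {..<CARD('n)} UNIV" by simp
  have 2: "bij_betw (\<lambda>k. k - 1) {1..CARD('n)} {..<CARD('n)}"
    by (rule bij_betwI[of _ _ _ Suc]) auto
  show ?thesis
    using bij_betw_trans[OF 2 1] by (simp add: comp_def idx_def[abs_def])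
qed

lemma idx_less:
  assumes "1 \<le> i" "i < j" "j \<le> CARD('n::{finite,wellorder})"
  shows "(idx i :: 'n) < idx j"
  using assms sorted_wrt_nth_less[OF strict_sorted_list_of_set[of "UNIV :: 'n set"], of "i - 1" "j - 1"]
  by (simp add: idx_def)

lemma idx_le_iff:
  assumes "i \<in> {1..CARD('n::{finite,wellorder})}" "j \<in> {1..CARD('n)}"
  shows "(idx i :: 'n) \<le> idx j \<longleftrightarrow> i \<le> j"
  using assms idx_less[of i j] idx_less[of j i] by (cases i j rule: linorder_cases) fastforce+

lemma atMost_idx:
  assumes "k \<in> {1..CARD('n::{finite,wellorder})}"
  shows "{..idx k :: 'n} = idx ` {1..k}"
proof (intro set_eqI iffI)
  fix x :: 'n assume "x \<in> {..idx k}"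
  moreover obtain i where "i \<in> {1..CARD('n)}" "x = idx i"
    using bij_betw_imp_surj_on[OF bij_betw_idx[where 'n = 'n]] by blast
  ultimately show "x \<in> idx ` {1..k}" using idx_le_iff[where 'n = 'n] assms by auto
next
  fix x :: 'n assume "x \<in> idx ` {1..k}"
  then obtain i where i: "x = idx i" "1 \<le> i" "i \<le> k" by auto
  then show "x \<in> {..idx k}"
    using assms idx_le_iff[of i k, where 'n = 'n] by auto
qed

lemma inj_on_idx: "L \<le> CARD('n::{finite,wellorder}) \<Longrightarrow> inj_on (idx :: nat \<Rightarrow> 'n) {1..L}"
  using bij_betw_idx[where 'n = 'n] by (rule inj_on_subset[OF bij_betw_imp_inj_on]) auto

lemma card_atMost_idx: "k \<in> {1..CARD('n::{finite,wellorder})} \<Longrightarrow> card {..idx k :: 'n} = k"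
  using card_image[OF inj_on_idx[of k, where 'n = 'n]] by (simp add: atMost_idx)

lemma initial_segment_idx:
  "L \<le> CARD('n::{finite,wellorder}) \<Longrightarrow> initial_segment (idx ` {1..L} :: 'n set)"
  unfolding initial_segment_def
proof (intro ballI allI impI)
  fix i j :: 'n assume L: "L \<le> CARD('n)" and ij: "i \<in> idx ` {1..L}" "j \<le> i"
  then obtain k where k: "k \<in> {1..L}" "i = idx k" by auto
  then have "j \<in> idx ` {1..k}"
    using atMost_idx[of k, where 'n = 'n] ij L by auto
  then show "j \<in> idx ` {1..L}" using k by auto
qed

lemma prod_singular_value_eq_gain:
  fixes M :: "'n::{finite,wellorder} mat"
  assumes "L \<le> CARD('n)"
  shows "(\<Prod>k=1..L. singular_value k M) = gain (idx ` {1..L}) M"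
  unfolding gain_def singular_value_def by (subst prod.reindex[OF inj_on_idx[OF assms]]) simp

primrec method_flow ::
  "(real \<Rightarrow> real \<Rightarrow> 'n::{finite,wellorder} mat) \<Rightarrow> (nat \<Rightarrow> real) \<Rightarrow> nat \<Rightarrow> 'n mat" where
  "method_flow \<Phi> h 0 = mat 1"
| "method_flow \<Phi> h (Suc n) = \<Phi> (grid h n) (h (Suc n)) ** method_flow \<Phi> h n"

lemma orthogonal_matrix_imp_invertible: "orthogonal_matrix Q \<Longrightarrow> invertible Q"
  unfolding orthogonal_matrix_def invertible_def by blast

lemma invertible_benettin_V:
  assumes "invertible V0" "\<And>n. invertible (\<Phi> (grid h n) (h (Suc n)))"
  shows "invertible (benettin_V \<Phi> h V0 n)"
proof (induction n)
  case (Suc n)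
  have "is_qr (\<Phi> (grid h n) (h (Suc n)) ** benettin_V \<Phi> h V0 n) (benettin_V \<Phi> h V0 (Suc n))
      (benettin_R \<Phi> h V0 (Suc n))"
    unfolding benettin_V.simps benettin_R_def diff_Suc_1
    by (intro is_qr_qr invertible_mult assms Suc)
  then show ?case
    by (simp only: is_qr_def orthogonal_matrix_imp_invertible)
qed (simp add: assms)

lemma benettin_step:
  assumes "invertible V0" "\<And>n. invertible (\<Phi> (grid h n) (h (Suc n)))"
  shows "is_qr (\<Phi> (grid h n) (h (Suc n)) ** benettin_V \<Phi> h V0 n) (benettin_V \<Phi> h V0 (Suc n))
      (benettin_R \<Phi> h V0 (Suc n))"
  unfolding benettin_V.simps benettin_R_def diff_Suc_1
  by (intro is_qr_qr invertible_mult invertible_benettin_V assms)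

text \<open>Each triangular factor acts on the wedge of the leading basis vectors as a scalar, so
  reorthonormalization changes the wedge of the leading columns only by factors read off from the
  diagonals of the \<open>R\<close> matrices.\<close>

lemma tensor_pow_method_flow:
  assumes V0: "invertible V0" and \<Phi>: "\<And>n. invertible (\<Phi> (grid h n) (h (Suc n)))"
    and S: "initial_segment S"
  shows "tensor_pow S (method_flow \<Phi> h n ** V0) *v wedge_basis S =
    (\<Prod>k=1..n. \<Prod>i\<in>S. benettin_R \<Phi> h V0 k $ i $ i) *s (tensor_pow S (benettin_V \<Phi> h V0 n) *v wedge_basis S)"
proof (induction n)
  case (Suc n)
  let ?w = "wedge_basis S" and ?\<Phi> = "\<Phi> (grid h n) (h (Suc n))" and ?V = "benettin_V \<Phi> h V0"
  let ?R = "benettin_R \<Phi> h V0 (Suc n)" and ?c = "\<Prod>k=1..n. \<Prod>i\<in>S. benettin_R \<Phi> h V0 k $ i $ i"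
  have qr: "?\<Phi> ** ?V n = ?V (Suc n) ** ?R" "\<And>i j. j < i \<Longrightarrow> ?R $ i $ j = 0"
    using benettin_step[of V0 \<Phi> h n, OF V0 \<Phi>] by (auto simp only: is_qr_def)
  have "tensor_pow S (method_flow \<Phi> h (Suc n) ** V0) *v ?w =
      tensor_pow S ?\<Phi> *v (tensor_pow S (method_flow \<Phi> h n ** V0) *v ?w)"
    by (simp add: matrix_vector_mul_assoc flip: tensor_pow_mult matrix_mul_assoc)
  also have "\<dots> = ?c *s (tensor_pow S (?\<Phi> ** ?V n) *v ?w)"
    unfolding Suc by (simp add: vector_scalar_commute tensor_pow_mult matrix_vector_mul_assoc)
  also have "\<dots> = ?c *s (tensor_pow S (?V (Suc n)) *v (tensor_pow S ?R *v ?w))"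
    unfolding qr(1) by (simp only: tensor_pow_mult matrix_vector_mul_assoc)
  also have "tensor_pow S ?R *v ?w = (\<Prod>i\<in>S. ?R $ i $ i) *s ?w"
    using qr(2) S by (intro tensor_pow_triangular) (auto simp: initial_segment_def)
  finally show ?case
    by (simp add: vector_scalar_commute vector_smult_assoc prod.nat_ivl_Suc' mult.commute)
qed simp

lemma sum_benettin_output:
  fixes V0 :: "'n::{finite,wellorder} mat"
  assumes V0: "invertible V0" and \<Phi>: "\<And>n. invertible (\<Phi> (grid h n) (h (Suc n)))"
    and L: "L \<le> CARD('n)" and n: "n > 0"
  defines "S \<equiv> idx ` {1..L}"
  shows "(\<Sum>i=1..L. benettin_output \<Phi> h V0 i n) =
    (ln (norm (tensor_pow S (method_flow \<Phi> h n ** V0) *v wedge_basis S)) - ln (norm (wedge_basis S))) / grid h n"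
proof -
  let ?R = "benettin_R \<Phi> h V0"
  have R: "0 < ?R k $ i $ i" if "k \<in> {1..n}" for k i
  proof -
    obtain l where "k = Suc l" using \<open>k \<in> {1..n}\<close> by (cases k) auto
    then show ?thesis using benettin_step[of V0 \<Phi> h l, OF V0 \<Phi>] by (simp only: is_qr_def)
  qed
  obtain l where l: "n = Suc l" using n by (cases n) auto
  \<comment> \<open>From the first step on the frame is a \<open>Q\<close> factor, which leaves the
    norm of the wedge unchanged. What remains is the norm of \<open>wedge_basis S\<close>, which
    differs from 1 in general and is subtracted in the statement.\<close>
  have "orthogonal_matrix (benettin_V \<Phi> h V0 n)"
    using benettin_step[of V0 \<Phi> h l, OF V0 \<Phi>] by (simp only: is_qr_def l)
  moreover define c where "c = (\<Prod>k=1..n. \<Prod>i\<in>S. ?R k $ i $ i)"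
  moreover have c: "0 < c"
    unfolding c_def using R by (intro prod_pos) auto
  ultimately have norm_eq: "norm (tensor_pow S (method_flow \<Phi> h n ** V0) *v wedge_basis S) = c * norm (wedge_basis S)"
    unfolding S_def tensor_pow_method_flow[of V0 \<Phi> h, OF V0 \<Phi> initial_segment_idx[OF L]]
    by (simp only: norm_tensor_pow_orthogonal scalar_mult_eq_scaleR norm_scaleR abs_of_pos)
  have "ln c = (\<Sum>k=1..n. ln (\<Prod>i\<in>S. ?R k $ i $ i))"
    unfolding c_def
  proof (rule ln_prod)
    fix k assume "k \<in> {1..n}"
    then have "0 < (\<Prod>i\<in>S. ?R k $ i $ i)" using R by (intro prod_pos) blast
    then show "(\<Prod>i\<in>S. ?R k $ i $ i) \<noteq> 0" by linarith
  qed simp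
  also have "\<dots> = (\<Sum>k=1..n. \<Sum>i\<in>S. ln (?R k $ i $ i))"
  proof (intro sum.cong refl ln_prod)
    fix k i assume "k \<in> {1..n}"
    from R[OF this, of i] show "?R k $ i $ i \<noteq> 0" by simp
  qed simp
  finally have "ln (norm (tensor_pow S (method_flow \<Phi> h n ** V0) *v wedge_basis S)) =
      (\<Sum>k=1..n. \<Sum>i\<in>S. ln (?R k $ i $ i)) + ln (norm (wedge_basis S))"
    using wedge_basis_nonzero[of S] c by (simp add: norm_eq ln_mult)
  moreover have "(\<Sum>i\<in>S. ln (?R k $ i $ i)) = (\<Sum>i=1..L. ln (?R k $ idx i $ idx i))" for k
    unfolding S_def by (subst sum.reindex[OF inj_on_idx[OF L]]) simp
  ultimately show ?thesis
    unfolding benettin_output_def sum_divide_distrib[symmetric] by (subst sum.swap) simp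
qed

section \<open>Generic initial frames\<close>

text \<open>On almost every line through \<open>a\<close> the zeros are finitely many, so by Fubini some dilation of the
  zero set about \<open>a\<close>, hence the zero set itself, is a null set.\<close>

lemma real_polynomial_function_nonzero_AE:
  fixes F :: "'a::euclidean_space \<Rightarrow> real"
  assumes F: "real_polynomial_function F" and a: "F a \<noteq> 0"
  shows "AE x in lborel. F x \<noteq> 0"
proof -
  have cont: "continuous_on UNIV F"
    using F by (intro continuous_at_imp_continuous_on ballI continuous_real_polymonial_function)
  have [measurable]: "F \<in> borel_measurable borel"
    using cont by (rule borel_measurable_continuous_onI)
  have "continuous_on UNIV (\<lambda>x :: real \<times> 'a. F (a + fst x *\<^sub>R snd x))"
    by (intro continuous_on_compose2[OF cont] continuous_intros) auto
  then have [measurable]: "(\<lambda>x. F (a + fst x *\<^sub>R snd x)) \<in> borel_measurable (lborel \<Otimes>\<^sub>M lborel)"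
    by (simp add: lborel_prod borel_measurable_continuous_onI)
  have "AE c in lborel. F (a + c *\<^sub>R x) \<noteq> 0" for x
  proof -
    have "polynomial_function (\<lambda>c :: real. a + c *\<^sub>R x)"
      by (intro polynomial_function_add polynomial_function_const polynomial_function_bounded_linear
          bounded_linear_scaleR_left)
    then have "real_polynomial_function (F \<circ> (\<lambda>c. a + c *\<^sub>R x))"
      using F by (rule real_polynomial_function_compose)
    then obtain b n where b: "F \<circ> (\<lambda>c. a + c *\<^sub>R x) = (\<lambda>c. \<Sum>i\<le>n. b i * c ^ i)"
      unfolding real_polynomial_function_iff_sum by blast
    then have b': "F (a + c *\<^sub>R x) = (\<Sum>i\<le>n. b i * c ^ i)" for c
      by (simp add: fun_eq_iff)
    \<comment> \<open>The constant coefficient is the value at \<open>c = 0\<close>, namely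
      \<open>F a\<close>.\<close>
    have "b 0 \<noteq> 0"
      using b'[of 0] a by (simp add: power_0_left sum.delta if_distrib cong: if_cong)
    then have "finite {c. F (a + c *\<^sub>R x) = 0}"
      unfolding b' by (intro polyfun_finite_roots[THEN iffD2] exI[of _ 0]) auto
    then show ?thesis
      by (intro AE_I'[of "{c. F (a + c *\<^sub>R x) = 0}"] finite_imp_null_set_lborel) auto
  qed
  then have "AE x in lborel. AE c in lborel. F (a + c *\<^sub>R x) \<noteq> 0" by simp
  moreover have set: "{x \<in> space (lborel \<Otimes>\<^sub>M lborel). F (a + fst x *\<^sub>R snd x) \<noteq> 0} \<in> sets (lborel \<Otimes>\<^sub>M lborel)"
    by measurable
  ultimately have "AE c in lborel. AE x in lborel. F (a + c *\<^sub>R x) \<noteq> 0"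
    by (subst lborel_pair.AE_commute[OF set]) auto
  moreover have "AE c :: real in lborel. c \<noteq> 0"
    by (rule AE_lborel_singleton)
  ultimately have "AE c in lborel. c \<noteq> 0 \<and> (AE x in lborel. F (a + c *\<^sub>R x) \<noteq> 0)"
    by eventually_elim auto
  from eventually_happens'[OF _ this] obtain c where c: "c \<noteq> 0" "AE x in lborel. F (a + c *\<^sub>R x) \<noteq> 0"
    by (auto simp: ae_filter_eq_bot_iff)
  \<comment> \<open>Since \<open>c \<noteq> 0\<close>, the map taking \<open>x\<close> to
    \<open>a + c *\<^sub>R x\<close> changes Lebesgue measure only by a constant density, so the
    null set can be transported.\<close>
  show ?thesis
    by (subst lborel_affine[OF c(1), of a])
      (use c(2) in \<open>simp add: AE_density AE_distr_iff\<close>)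
qed

lemma real_polynomial_function_tensor_pow:
  "real_polynomial_function (\<lambda>A. (tensor_pow S A *v T) $ f)"
proof -
  have "real_polynomial_function (\<lambda>A. (if i \<in> S then A else mat 1) $ a $ b)" for i a b
    by (cases "i \<in> S") (auto intro: real_polynomial_function.intros(1,2)
        bounded_linear_compose[OF bounded_linear_vec_nth bounded_linear_vec_nth])
  then show ?thesis
    unfolding tensor_pow_def matrix_vector_mult_def vec_lambda_beta
    by (intro real_polynomial_function_sum real_polynomial_function_prod real_polynomial_function.intros(2,4)) auto
qed

lemma bounded_linear_mult_transpose:
  fixes M :: "real^'n^'n"
  shows "bounded_linear (\<lambda>v. M ** transpose v)" "bounded_linear (\<lambda>v. transpose v ** M)"
  by (auto intro!: linear_conv_bounded_linear[THEN iffD1] linearI simp: vec_eq_iff matrix_matrix_mult_def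
      transpose_def algebra_simps sum.distrib sum_distrib_left)

lemma norm_orthogonal_matrix_le:
  fixes Q :: "real^'n^'n"
  assumes "orthogonal_matrix Q"
  shows "norm Q \<le> CARD('n)"
proof -
  have "norm (Q $ i) = 1" for i
    using assms by (simp add: orthogonal_matrix_orthonormal_rows row_def)
  then show ?thesis
    unfolding norm_vec_def[of Q] using L2_set_le_sum[of UNIV "\<lambda>i. norm (Q $ i)"] by simp
qed

text \<open>Along a subsequence the right singular frames \<open>V k\<close> of \<open>Z k\<close> converge to some \<open>V\<close>. The
  component of a frame in the limiting top singular direction is a nonzero polynomial, and where it
  does not vanish the bound at the times \<open>r k\<close> propagates backwards to all times.\<close>

lemma AE_wedge_grows_like_gain:
  fixes Z :: "real \<Rightarrow> 'n::{finite,wellorder} mat"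
  assumes S: "initial_segment S"
    and Z: "\<And>t. 0 \<le> t \<Longrightarrow> invertible (Z t)"
    and W: "\<And>s t. 0 \<le> s \<Longrightarrow> s \<le> t \<Longrightarrow> invertible (W t s)"
    and cocycle: "\<And>s t. 0 \<le> s \<Longrightarrow> s \<le> t \<Longrightarrow> Z t = W t s ** Z s"
    and C: "\<And>s t. 0 \<le> s \<Longrightarrow> s \<le> t \<Longrightarrow> gain S (W t s) * gain S (Z s) \<le> C * gain S (Z t)"
  shows "AE v in lebesgue. \<exists>\<eta>>0. \<forall>t\<ge>0.
    \<eta> * gain S (Z t) \<le> norm (tensor_pow S (Z t ** transpose v) *v wedge_basis S)"
proof -
  let ?w = "wedge_basis S"
  have "\<exists>V. orthogonal_matrix V \<and> (\<forall>T. gain S (Z (real k)) * \<bar>(tensor_pow S (transpose V) *v T) $ id\<bar>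
      \<le> norm (tensor_pow S (Z (real k)) *v T))" for k
    by (rule gain_component_le_norm_tensor_pow) (simp add: Z)
  then obtain V :: "nat \<Rightarrow> 'n mat" where V: "\<And>k. orthogonal_matrix (V k)"
      "\<And>k T. gain S (Z (real k)) * \<bar>(tensor_pow S (transpose (V k)) *v T) $ id\<bar>
      \<le> norm (tensor_pow S (Z (real k)) *v T)"
    by metis
  have "bounded (range V)"
    by (intro boundedI[of _ "CARD('n)"]) (auto intro: norm_orthogonal_matrix_le V)
  then obtain V0 r where r: "strict_mono r" "(V \<circ> r) \<longlonglongrightarrow> V0"
    using bounded_imp_convergent_subsequence by blast
  have orth: "transpose V0 ** V0 = mat 1"
  proof -
    have "(transpose V0 ** V0) $ i $ j = mat 1 $ i $ j" for i j
    proof (rule LIMSEQ_unique)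
      show "(\<lambda>k. (transpose (V (r k)) ** V (r k)) $ i $ j) \<longlonglongrightarrow> (transpose V0 ** V0) $ i $ j"
        using r(2) unfolding matrix_matrix_mult_def transpose_def comp_def vec_lambda_beta
        by (intro tendsto_sum tendsto_mult tendsto_vec_nth)
      show "(\<lambda>k. (transpose (V (r k)) ** V (r k)) $ i $ j) \<longlonglongrightarrow> mat 1 $ i $ j"
        using V(1) by (simp add: orthogonal_matrix)
    qed
    then show ?thesis by (simp add: vec_eq_iff)
  qed
  define F where "F v = (tensor_pow S (transpose V0 ** transpose v) *v ?w) $ id" for v
  have "real_polynomial_function F"
    using real_polynomial_function_compose[OF polynomial_function_bounded_linear[OF
        bounded_linear_mult_transpose(1)[of "transpose V0"]] real_polynomial_function_tensor_pow[of S ?w id]]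
    by (simp add: comp_def F_def[abs_def])
  \<comment> \<open>The frame whose columns are those of \<open>V0\<close> itself has component 1 in
    the limiting direction.\<close>
  moreover have "F (transpose V0) \<noteq> 0"
    by (simp add: F_def orth tensor_pow_mat1 wedge_basis_def permutes_id)
  ultimately have "AE v in lborel. F v \<noteq> 0"
    by (rule real_polynomial_function_nonzero_AE)
  then have "AE v in lebesgue. F v \<noteq> 0"
    by (rule AE_completion)
  then show ?thesis
  proof eventually_elim
    case (elim v)
    let ?T = "tensor_pow S (transpose v) *v ?w"
    let ?G = "\<lambda>U. (tensor_pow S (transpose U ** transpose v) *v ?w) $ id"
    have "real_polynomial_function ?G"
      using real_polynomial_function_compose[OF polynomial_function_bounded_linear[OF
          bounded_linear_mult_transpose(2)[of "transpose v"]] real_polynomial_function_tensor_pow[of S ?w id]]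
      by (simp add: comp_def)
    then have "isCont ?G V0"
      by (rule continuous_real_polymonial_function)
    then have "(\<lambda>k. \<bar>?G (V (r k))\<bar>) \<longlonglongrightarrow> \<bar>F v\<bar>"
      using r(2) unfolding F_def comp_def by (intro tendsto_rabs) (rule isCont_tendsto_compose)
    then have "eventually (\<lambda>k. \<bar>F v\<bar> / 2 < \<bar>?G (V (r k))\<bar>) sequentially"
      using elim by (intro order_tendstoD(1)) auto
    then obtain N where N: "\<And>k. k \<ge> N \<Longrightarrow> \<bar>F v\<bar> / 2 < \<bar>?G (V (r k))\<bar>"
      by (auto simp: eventually_sequentially)
    have C0: "C > 0"
    proof -
      have "0 < gain S (W 0 0) * gain S (Z 0)"
        by (intro mult_pos_pos gain_pos W Z) auto
      then have "0 < C * gain S (Z 0)" using C[of 0 0] by linarith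
      then show ?thesis using gain_pos[OF Z[of 0], of S] by (simp add: zero_less_mult_iff)
    qed
    \<comment> \<open>At some \<open>u = r k\<close> beyond \<open>t\<close> the component exceeds
      half its limit, so the norm at \<open>u\<close> is at least
      \<open>gain S (Z u) * (\<bar>F v\<bar> / 2)\<close>. It is also at most
      \<open>gain S (W u t)\<close> times the norm at \<open>t\<close>; fast invertibility bounds
      \<open>gain S (W u t) * gain S (Z t)\<close> by \<open>C * gain S (Z u)\<close>, and
      \<open>gain S (Z u)\<close> cancels.\<close>
    have "\<bar>F v\<bar> / (2 * C) * gain S (Z t) \<le> norm (tensor_pow S (Z t ** transpose v) *v ?w)" if t: "t \<ge> 0" for t
    proof -
      obtain k where k: "k \<ge> N" "t \<le> real k"
        by (metis le_trans max.cobounded1 max.cobounded2 of_nat_le_iff real_nat_ceiling_ge order_trans)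
      define u where "u = real (r k)"
      have u: "t \<le> u"
        using k(2) seq_suble[OF r(1), of k] by (simp add: u_def)
      have g: "0 < gain S (Z u)" "0 < gain S (Z t)" using t u by (auto intro!: gain_pos Z)
      have eq: "?G (V (r k)) = (tensor_pow S (transpose (V (r k))) *v ?T) $ id"
        by (simp add: tensor_pow_mult matrix_vector_mul_assoc)
      have "gain S (Z u) * (\<bar>F v\<bar> / 2) \<le> gain S (Z u) * \<bar>?G (V (r k))\<bar>"
        using N[OF k(1)] g by (intro mult_left_mono) auto
      also have "\<dots> \<le> norm (tensor_pow S (Z u) *v ?T)"
        unfolding eq using V(2)[of "r k" ?T] by (simp add: u_def)
      also have "tensor_pow S (Z u) *v ?T = tensor_pow S (W u t) *v (tensor_pow S (Z t) *v ?T)"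
        unfolding cocycle[OF t u] by (simp only: tensor_pow_mult matrix_vector_mul_assoc matrix_mul_assoc)
      also have "norm \<dots> \<le> gain S (W u t) * norm (tensor_pow S (Z t) *v ?T)"
        by (intro norm_tensor_pow_le_gain W t u S alternating_tensor_pow alternating_wedge_basis)
      finally have "gain S (Z u) * (\<bar>F v\<bar> / 2) * gain S (Z t)
          \<le> (gain S (W u t) * gain S (Z t)) * norm (tensor_pow S (Z t) *v ?T)"
        using g by (simp add: mult_right_mono mult_ac)
      also have "\<dots> \<le> (C * gain S (Z u)) * norm (tensor_pow S (Z t) *v ?T)"
        by (intro mult_right_mono C t u) auto
      finally have "\<bar>F v\<bar> / 2 * gain S (Z t) \<le> C * norm (tensor_pow S (Z t) *v ?T)"
        using g by (simp add: mult_ac)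
      then show ?thesis
        using C0 by (simp add: field_simps tensor_pow_mult matrix_vector_mul_assoc)
    qed
    moreover have "\<bar>F v\<bar> / (2 * C) > 0" using elim C0 by simp
    ultimately show ?case by blast
  qed
qed

lemma AE_invertible:
  "AE v in (lebesgue :: (real^'n^'n) measure). invertible (transpose v)"
proof -
  have "real_polynomial_function (\<lambda>v :: real^'n^'n. v $ i $ j)" for i j
    by (auto intro!: real_polynomial_function.intros(1)
        bounded_linear_compose[OF bounded_linear_vec_nth bounded_linear_vec_nth])
  then have "real_polynomial_function (det :: real^'n^'n \<Rightarrow> real)"
    unfolding det_def[abs_def]
    by (intro real_polynomial_function_sum real_polynomial_function_prod real_polynomial_function.intros(4))
      (auto simp: finite_permutations)
  then have "AE v in (lborel :: (real^'n^'n) measure). det v \<noteq> 0"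
    by (rule real_polynomial_function_nonzero_AE[of _ "mat 1"]) simp
  from AE_completion[OF this] show ?thesis
    by eventually_elim (simp add: invertible_det_nz)
qed

section \<open>Linear systems with bounded coefficients\<close>

lemma norm_matrix_vector_mult_le:
  fixes M :: "real^'n^'m"
  assumes "\<And>i j. \<bar>M $ i $ j\<bar> \<le> B"
  shows "norm (M *v x) \<le> real (CARD('m)) * real (CARD('n)) * B * norm x"
  using onorm[OF matrix_vector_mul_bounded_linear, of M x] onorm_le_matrix_component[of M B, OF assms]
  by (meson mult_right_mono norm_ge_zero order_trans)

text \<open>With \<open>1 \<le> B\<close> the entries of the identity slots are covered too, which
  gives one exponent for all \<open>S\<close>.\<close>

lemma abs_tensor_pow_le:
  fixes M :: "real^'n^'n"
  assumes "\<And>i j. \<bar>M $ i $ j\<bar> \<le> B" "1 \<le> B"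
  shows "\<bar>tensor_pow S M $ f $ g\<bar> \<le> B ^ CARD('n)"
proof -
  have "\<bar>tensor_pow S M $ f $ g\<bar> = (\<Prod>i\<in>UNIV. \<bar>(if i \<in> S then M else mat 1) $ f i $ g i\<bar>)"
    by (simp add: tensor_pow_def abs_prod)
  also have "\<dots> \<le> (\<Prod>i\<in>(UNIV :: 'n set). B)"
    using assms by (intro prod_mono) (auto simp: mat_def)
  finally show ?thesis by simp
qed

lemma prod_diff_le:
  fixes a b :: "'i \<Rightarrow> real"
  assumes "\<And>i. i \<in> I \<Longrightarrow> \<bar>a i\<bar> \<le> B" "\<And>i. i \<in> I \<Longrightarrow> \<bar>b i\<bar> \<le> B"
    and "\<And>i. i \<in> I \<Longrightarrow> \<bar>a i - b i\<bar> \<le> \<delta>" and B: "1 \<le> B" "0 \<le> \<delta>"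
  shows "\<bar>prod a I - prod b I\<bar> \<le> real (card I) * B ^ card I * \<delta>"
proof -
  \<comment> \<open>The telescoping estimate for products needs factors of absolute value at most 1,
    hence the scaling by \<open>B\<close>.\<close>
  have "norm ((\<Prod>i\<in>I. a i / B) - (\<Prod>i\<in>I. b i / B)) \<le> (\<Sum>i\<in>I. norm (a i / B - b i / B))"
    using assms by (intro norm_prod_diff) auto
  also have "\<dots> \<le> (\<Sum>i\<in>I. \<delta>)"
  proof (rule sum_mono)
    fix i assume "i \<in> I"
    then have "\<bar>a i - b i\<bar> / B \<le> \<delta> / 1"
      using assms by (intro frac_le) auto
    then show "norm (a i / B - b i / B) \<le> \<delta>"
      using B by (simp flip: diff_divide_distrib)
  qed
  finally have "\<bar>prod a I - prod b I\<bar> / B ^ card I \<le> real (card I) * \<delta>"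
    using B by (simp add: prod_dividef flip: diff_divide_distrib)
  then show ?thesis
    using B by (simp add: field_simps)
qed

lemma tensor_pow_diff_le:
  fixes P Q :: "real^'n^'n" and T :: "real^('n \<Rightarrow> 'n)"
  assumes "\<And>i j. \<bar>P $ i $ j\<bar> \<le> B" "\<And>i j. \<bar>Q $ i $ j\<bar> \<le> B" "1 \<le> B"
    and "\<And>i j. \<bar>P $ i $ j - Q $ i $ j\<bar> \<le> \<delta>"
  shows "norm (tensor_pow S P *v T - tensor_pow S Q *v T)
    \<le> (real CARD('n \<Rightarrow> 'n) * real CARD('n \<Rightarrow> 'n) * (real CARD('n) * B ^ CARD('n))) * \<delta> * norm T"
proof -
  have \<delta>: "0 \<le> \<delta>" using assms(4) abs_ge_zero order_trans by blast
  have "\<bar>(tensor_pow S P - tensor_pow S Q) $ f $ g\<bar> \<le> real CARD('n) * B ^ CARD('n) * \<delta>" for f g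
    unfolding vector_minus_component tensor_pow_def vec_lambda_beta
    using assms \<delta> by (intro prod_diff_le) (auto simp: mat_def)
  from norm_matrix_vector_mult_le[OF this, of T] show ?thesis
    by (simp add: matrix_vector_mult_diff_rdistrib mult_ac)
qed

lemma abs_component_le:
  fixes M :: "real^'n^'m"
  assumes "\<And>x. norm (M *v x) \<le> B * norm x"
  shows "\<bar>M $ i $ j\<bar> \<le> B"
proof -
  have "\<bar>M $ i $ j\<bar> \<le> norm (M *v axis j 1)"
    using component_le_norm_cart[of "M *v axis j 1" i] by (simp add: matrix_vector_mult_basis column_def)
  also have "\<dots> \<le> B" using assms[of "axis j 1"] by simp
  finally show ?thesis .
qed

locale bounded_linear_system =
  fixes A X :: "real \<Rightarrow> 'n::{finite,wellorder} mat"
  assumes bounded_A: "bounded (A ` {0..})" and fundamental: "fundamental_matrix A X"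
begin

definition growth :: real where
  "growth = (SOME M. 0 \<le> M \<and> (\<forall>t\<ge>0. \<forall>x. norm (A t *v x) \<le> M * norm x))"

lemma growth: "0 \<le> growth" "0 \<le> t \<Longrightarrow> norm (A t *v x) \<le> growth * norm x"
proof -
  obtain B where B: "\<And>t. 0 \<le> t \<Longrightarrow> norm (A t) \<le> B"
    using bounded_A by (auto simp: bounded_iff)
  have "\<bar>A t $ i $ j\<bar> \<le> B" if "0 \<le> t" for t i j
    using B[OF that] component_le_norm_cart[of "A t $ i" j] Finite_Cartesian_Product.norm_nth_le[of "A t" i]
    by simp
  then have "norm (A t *v x) \<le> real CARD('n) * real CARD('n) * B * norm x" if "0 \<le> t" for t x
    using that by (intro norm_matrix_vector_mult_le)
  moreover have "0 \<le> B" using B[of 0] norm_ge_zero order_trans by blast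
  ultimately have "\<exists>M. 0 \<le> M \<and> (\<forall>t\<ge>0. \<forall>x. norm (A t *v x) \<le> M * norm x)"
    by (intro exI[of _ "real CARD('n) * real CARD('n) * B"]) auto
  from someI_ex[OF this] show "0 \<le> growth" "0 \<le> t \<Longrightarrow> norm (A t *v x) \<le> growth * norm x"
    by (auto simp: growth_def)
qed

text \<open>Gronwall in both time directions: \<open>c = 1\<close> makes the squared norm times
  \<open>exp (- 2 * growth * t)\<close> decreasing, and \<open>c = -1\<close> makes the squared norm
  times \<open>exp (2 * growth * t)\<close> increasing. The forward bound also yields uniqueness of
  solutions.\<close>

lemma solution_norm_bounds:
  assumes y: "solution A y" and st: "0 \<le> s" "s \<le> t"
  shows "norm (y t) \<le> exp (growth * (t - s)) * norm (y s)"
    and "norm (y s) \<le> exp (growth * (t - s)) * norm (y t)"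
proof -
  have mono: "c = 1 \<or> c = -1 \<Longrightarrow>
      c * ((y t \<bullet> y t) * exp (- 2 * c * growth * t)) \<le> c * ((y s \<bullet> y s) * exp (- 2 * c * growth * s))" for c :: real
  proof (rule DERIV_nonpos_imp_decreasing_open[OF st(2), where f = "\<lambda>t. c * ((y t \<bullet> y t) * exp (- 2 * c * growth * t))"])
    assume c: "c = 1 \<or> c = -1"
    have y': "(y has_vector_derivative A x *v y x) (at x within {0..})" if "0 \<le> x" for x
      using y that by (simp add: solution_def)
    have "continuous_on {0..} y"
      using y' by (intro continuous_on_vector_derivative) auto
    then have "continuous_on {s..t} y" by (rule continuous_on_subset) (use st in auto)
    then show "continuous_on {s..t} (\<lambda>t. c * ((y t \<bullet> y t) * exp (- 2 * c * growth * t)))"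
      by (intro continuous_intros)
    fix x assume x: "s < x" "x < t"
    then have "x > 0" using st by simp
    then have yx: "(y has_vector_derivative A x *v y x) (at x)"
      using y'[of x] at_within_interior[of x "{0..}"] by (simp add: interior_real_atLeast)
    have "((\<lambda>t. y t \<bullet> y t) has_real_derivative 2 * (y x \<bullet> (A x *v y x))) (at x)"
      using bounded_bilinear.has_vector_derivative[OF bounded_bilinear_inner yx yx]
      by (simp add: has_real_derivative_iff_has_vector_derivative inner_commute)
    then have "((\<lambda>t. c * ((y t \<bullet> y t) * exp (- 2 * c * growth * t))) has_real_derivative
        c * ((2 * (y x \<bullet> (A x *v y x)) - 2 * c * growth * (y x \<bullet> y x)) * exp (- 2 * c * growth * x))) (at x)"
      by (auto intro!: derivative_eq_intros simp: algebra_simps)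
    moreover have "c * ((2 * (y x \<bullet> (A x *v y x)) - 2 * c * growth * (y x \<bullet> y x)) * exp (- 2 * c * growth * x)) \<le> 0"
    proof -
      have "\<bar>y x \<bullet> (A x *v y x)\<bar> \<le> norm (y x) * norm (A x *v y x)"
        by (rule Cauchy_Schwarz_ineq2)
      also have "\<dots> \<le> norm (y x) * (growth * norm (y x))"
        using \<open>x > 0\<close> by (intro mult_left_mono growth) auto
      also have "\<dots> = growth * (y x \<bullet> y x)"
        by (simp add: power2_norm_eq_inner[symmetric] power2_eq_square)
      finally have "c * (2 * (y x \<bullet> (A x *v y x)) - 2 * c * growth * (y x \<bullet> y x)) \<le> 0"
        using c by auto
      then have "c * (2 * (y x \<bullet> (A x *v y x)) - 2 * c * growth * (y x \<bullet> y x)) * exp (- 2 * c * growth * x) \<le> 0"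
        by (rule mult_nonpos_nonneg) simp
      then show ?thesis by (simp only: mult.assoc)
    qed
    ultimately show "\<exists>d. ((\<lambda>t. c * ((y t \<bullet> y t) * exp (- 2 * c * growth * t))) has_real_derivative d) (at x) \<and> d \<le> 0"
      by blast
  qed
  have e: "(exp (growth * (t - s)))\<^sup>2 = exp (2 * growth * t) / exp (2 * growth * s)"
    by (simp add: power2_eq_square algebra_simps flip: exp_add exp_diff)
  have "(norm (y t))\<^sup>2 \<le> (exp (growth * (t - s)) * norm (y s))\<^sup>2"
    using mono[of 1] unfolding power_mult_distrib e power2_norm_eq_inner
    by (simp add: exp_minus field_simps)
  then show "norm (y t) \<le> exp (growth * (t - s)) * norm (y s)"
    by (rule power2_le_imp_le) auto
  have "(norm (y s))\<^sup>2 \<le> (exp (growth * (t - s)) * norm (y t))\<^sup>2"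
    using mono[of "-1"] unfolding power_mult_distrib e power2_norm_eq_inner
    by (simp add: exp_minus field_simps)
  then show "norm (y s) \<le> exp (growth * (t - s)) * norm (y t)"
    by (rule power2_le_imp_le) auto
qed

lemma invertible_X: "0 \<le> t \<Longrightarrow> invertible (X t)"
  using fundamental by (simp add: fundamental_matrix_def)

lemma X_inv: "0 \<le> t \<Longrightarrow> X t ** matrix_inv (X t) = mat 1" "0 \<le> t \<Longrightarrow> matrix_inv (X t) ** X t = mat 1"
  using invertible_X[of t] unfolding invertible_def matrix_inv_def by (metis (mono_tags, lifting) someI)+

lemma invertible_cauchy: "0 \<le> s \<Longrightarrow> 0 \<le> t \<Longrightarrow> invertible (cauchy_matrix X t s)"
  unfolding cauchy_matrix_def
  by (intro invertible_mult invertible_X) (auto simp: invertible_def intro!: exI[of _ "X s"] X_inv)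

lemma cauchy_cocycle:
  "0 \<le> s \<Longrightarrow> cauchy_matrix X t r = cauchy_matrix X t s ** cauchy_matrix X s r"
proof -
  assume s: "0 \<le> s"
  have "cauchy_matrix X t s ** cauchy_matrix X s r = X t ** (matrix_inv (X s) ** X s) ** matrix_inv (X r)"
    by (simp only: cauchy_matrix_def matrix_mul_assoc)
  then show ?thesis using X_inv[OF s] by (simp add: cauchy_matrix_def)
qed

lemma cauchy_self: "0 \<le> t \<Longrightarrow> cauchy_matrix X t t = mat 1"
  by (simp add: cauchy_matrix_def X_inv)

lemma solution_cauchy: "solution A (\<lambda>t. cauchy_matrix X t s *v x)"
proof -
  have "bounded_linear (\<lambda>M :: 'n mat. M *v c)" for c
    by (auto intro!: linear_conv_bounded_linear[THEN iffD1] linearI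
        simp: matrix_vector_mult_add_rdistrib scaleR_matrix_vector_assoc)
  from bounded_linear.has_vector_derivative[OF this, of X _ _ "matrix_inv (X s) *v x"] show ?thesis
    using fundamental
    by (auto simp: solution_def fundamental_matrix_def cauchy_matrix_def matrix_vector_mul_assoc matrix_mul_assoc)
qed

lemma norm_cauchy_le:
  assumes "0 \<le> s" "0 \<le> t" "\<bar>t - s\<bar> \<le> d"
  shows "norm (cauchy_matrix X t s *v x) \<le> exp (growth * d) * norm x"
proof -
  have "norm (cauchy_matrix X t s *v x) \<le> exp (growth * \<bar>t - s\<bar>) * norm x"
    using solution_norm_bounds[OF solution_cauchy[of s x], of s t]
      solution_norm_bounds[OF solution_cauchy[of s x], of t s] assms(1,2)
    by (cases "s \<le> t") (auto simp: cauchy_self)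
  also have "\<dots> \<le> exp (growth * d) * norm x"
    using growth(1) assms(3) by (intro mult_right_mono) (auto intro: mult_left_mono)
  finally show ?thesis .
qed

lemma solution_eq_cauchy:
  assumes "solution A x" "0 \<le> t"
  shows "x t = cauchy_matrix X t 0 *v x 0"
proof -
  let ?z = "\<lambda>t. x t - cauchy_matrix X t 0 *v x 0"
  have "solution A ?z"
    using assms(1) solution_cauchy[of 0 "x 0"]
    by (auto simp: solution_def matrix_vector_mult_diff_distrib intro!: has_vector_derivative_diff)
  from solution_norm_bounds(1)[OF this _ assms(2)] show ?thesis
    by (simp add: cauchy_self)
qed

end

section \<open>Lyapunov exponents and singular values\<close>

text \<open>Upper bounds on all rates whose sum is attained in the limit are attained individually.\<close>

lemma tendsto_of_sum_tight:
  fixes f :: "'i \<Rightarrow> 'b \<Rightarrow> real"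
  assumes I: "finite I"
    and upper: "\<And>i e. i \<in> I \<Longrightarrow> 0 < e \<Longrightarrow> eventually (\<lambda>t. f i t \<le> a i + e) F"
    and lower: "\<And>e. 0 < e \<Longrightarrow> eventually (\<lambda>t. (\<Sum>i\<in>I. a i) - e \<le> (\<Sum>i\<in>I. f i t)) F"
    and j: "j \<in> I"
  shows "(f j \<longlongrightarrow> a j) F"
proof (rule tendstoI)
  fix e :: real assume e: "0 < e"
  \<comment> \<open>In the lower bound for \<open>f j\<close> the other \<open>card I - 1\<close>
    terms and the sum each cost one \<open>d\<close>, so \<open>card I * d < e\<close> is
    required.\<close>
  define d where "d = e / (real (card I) + 1)"
  have d: "0 < d" using e by (simp add: d_def)
  have "eventually (\<lambda>t. \<forall>i\<in>I. f i t \<le> a i + d) F"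
    using upper d I by (intro eventually_ball_finite) auto
  then show "eventually (\<lambda>t. dist (f j t) (a j) < e) F"
    using lower[OF d]
  proof eventually_elim
    case (elim t)
    have "(\<Sum>i\<in>I - {j}. f i t) \<le> (\<Sum>i\<in>I - {j}. a i + d)"
      using elim by (intro sum_mono) auto
    also have "\<dots> = (\<Sum>i\<in>I - {j}. a i) + real (card I - 1) * d"
      using I j by (simp add: sum.distrib)
    finally have "(\<Sum>i\<in>I. f i t) - f j t \<le> (\<Sum>i\<in>I. a i) - a j + real (card I - 1) * d"
      using I j by (simp add: sum_diff1)
    moreover have "real (card I - 1) = real (card I) - 1"
      using I j by (metis card_gt_0_iff empty_iff of_nat_diff One_nat_def Suc_leI of_nat_1)
    ultimately have "a j - f j t \<le> real (card I) * d"
      using elim(2) by (simp add: left_diff_distrib)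
    moreover have "real (card I) * d < e" "d \<le> real (card I) * d"
    proof -
      show "real (card I) * d < e" using e by (simp add: d_def field_simps)
      have "0 < card I" using I j by (auto simp: card_gt_0_iff)
      then show "d \<le> real (card I) * d" using d by simp
    qed
    ultimately show ?case
      using elim(1) j by (fastforce simp: dist_real_def abs_less_iff)
  qed
qed

lemma lyapunov_exponent_le_imp_exp_bound:
  assumes "lyapunov_exponent x \<le> ereal l" "0 < e"
  shows "eventually (\<lambda>t. norm (x t) \<le> exp ((l + e) * t)) at_top"
proof -
  have "eventually (\<lambda>t. (if x t = 0 then -\<infinity> else ereal (ln (norm (x t)) / t)) < ereal (l + e)) at_top"
    using assms unfolding lyapunov_exponent_def Limsup_le_iff by auto
  then show ?thesis
    using eventually_gt_at_top[of 0]
  proof eventually_elim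
    case (elim t)
    show ?case
    proof (cases "x t = 0")
      case False
      then have "ln (norm (x t)) < (l + e) * t"
        using elim by (simp add: field_simps)
      then have "exp (ln (norm (x t))) < exp ((l + e) * t)" by simp
      then show ?thesis
        using False by simp
    qed simp
  qed
qed

context bounded_linear_system
begin

text \<open>The span has the same dimension as the space and is a subspace by construction; an
  exponential bound with a constant in front passes directly to linear combinations.\<close>

lemma span_lyapunov_space_bound:
  assumes "w \<in> span (lyapunov_space A l)" "0 < e"
  shows "\<exists>C\<ge>0. eventually (\<lambda>t. norm (cauchy_matrix X t 0 *v w) \<le> C * exp ((l + e) * t)) at_top"
  using assms(1)
proof (induction rule: span_induct_alt)
  case base
  show ?case by (auto intro!: exI[of _ 0])
next
  case (step c x y)
  then obtain z where z: "x = z 0" "solution A z" "lyapunov_exponent z \<le> ereal l"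
    by (auto simp: lyapunov_space_def)
  obtain C where C: "0 \<le> C" "eventually (\<lambda>t. norm (cauchy_matrix X t 0 *v y) \<le> C * exp ((l + e) * t)) at_top"
    using step by blast
  have "eventually (\<lambda>t. norm (cauchy_matrix X t 0 *v (c *\<^sub>R x + y)) \<le> (\<bar>c\<bar> + C) * exp ((l + e) * t)) at_top"
    using C(2) lyapunov_exponent_le_imp_exp_bound[OF z(3) assms(2)] eventually_ge_at_top[of 0]
  proof eventually_elim
    case (elim t)
    have "norm (cauchy_matrix X t 0 *v (c *\<^sub>R x + y)) \<le> \<bar>c\<bar> * norm (z t) + norm (cauchy_matrix X t 0 *v y)"
      using norm_triangle_ineq[of "c *\<^sub>R (cauchy_matrix X t 0 *v x)" "cauchy_matrix X t 0 *v y"]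
        solution_eq_cauchy[OF z(2) elim(3)] z(1)
      by (simp add: matrix_vector_right_distrib matrix_vector_mult_scaleR)
    also have "\<dots> \<le> \<bar>c\<bar> * exp ((l + e) * t) + C * exp ((l + e) * t)"
      using elim by (intro add_mono mult_left_mono) auto
    finally show ?case by (simp add: algebra_simps)
  qed
  then show ?case using C(1) by (intro exI[of _ "\<bar>c\<bar> + C"]) auto
qed

text \<open>The constant and the starting time of the previous bound depend on the vector. A finite
  orthonormal basis makes both uniform, as needed because the vector supplied by min-max changes
  with \<open>t\<close>.\<close>

lemma uniform_lyapunov_space_bound:
  assumes "0 < e"
  shows "\<exists>C>0. eventually (\<lambda>t. \<forall>w\<in>span (lyapunov_space A l).
    norm (cauchy_matrix X t 0 *v w) \<le> C * exp ((l + e) * t) * norm w) at_top"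
proof -
  let ?E = "span (lyapunov_space A l)"
  obtain B where B: "B \<subseteq> ?E" "pairwise orthogonal B" "\<And>x. x \<in> B \<Longrightarrow> norm x = 1"
      "independent B" "span B = ?E"
    using orthonormal_basis_subspace[OF subspace_span] by metis
  have fin: "finite B" by (rule independent_imp_finite[OF B(4)])
  have "\<forall>b\<in>B. \<exists>C\<ge>0. eventually (\<lambda>t. norm (cauchy_matrix X t 0 *v b) \<le> C * exp ((l + e) * t)) at_top"
    using span_lyapunov_space_bound assms B(1) by blast
  then obtain C where C: "\<And>b. b \<in> B \<Longrightarrow> 0 \<le> C b"
      "\<And>b. b \<in> B \<Longrightarrow> eventually (\<lambda>t. norm (cauchy_matrix X t 0 *v b) \<le> C b * exp ((l + e) * t)) at_top"
    by metis
  have "eventually (\<lambda>t. \<forall>b\<in>B. norm (cauchy_matrix X t 0 *v b) \<le> C b * exp ((l + e) * t)) at_top"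
    using fin C(2) by (intro eventually_ball_finite) auto
  then have "eventually (\<lambda>t. \<forall>w\<in>?E.
    norm (cauchy_matrix X t 0 *v w) \<le> (sum C B + 1) * exp ((l + e) * t) * norm w) at_top"
  proof eventually_elim
    case (elim t)
    show ?case
    proof
      fix w assume "w \<in> ?E"
      then have w: "(\<Sum>b\<in>B. (b \<bullet> w) *\<^sub>R b) = w"
        using orthonormal_basis_expand[OF B(2,3) _ fin, of w] B(5) by (simp add: inner_commute)
      have "norm (cauchy_matrix X t 0 *v w) = norm (\<Sum>b\<in>B. (b \<bullet> w) *\<^sub>R (cauchy_matrix X t 0 *v b))"
        by (subst w[symmetric]) (simp add: linear_sum[OF matrix_vector_mul_linear] matrix_vector_mult_scaleR)
      also have "\<dots> \<le> (\<Sum>b\<in>B. norm w * (C b * exp ((l + e) * t)))"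
      proof (rule sum_norm_le)
        fix b assume "b \<in> B"
        then have "\<bar>b \<bullet> w\<bar> \<le> norm w"
          using Cauchy_Schwarz_ineq2[of b w] B(3) by simp
        then show "norm ((b \<bullet> w) *\<^sub>R (cauchy_matrix X t 0 *v b)) \<le> norm w * (C b * exp ((l + e) * t))"
          using elim \<open>b \<in> B\<close> by (auto intro!: mult_mono)
      qed
      also have "\<dots> = sum C B * exp ((l + e) * t) * norm w"
        by (simp add: sum_distrib_left sum_distrib_right mult_ac)
      also have "\<dots> \<le> (sum C B + 1) * exp ((l + e) * t) * norm w"
        by (intro mult_right_mono) auto
      finally show "norm (cauchy_matrix X t 0 *v w) \<le> (sum C B + 1) * exp ((l + e) * t) * norm w" .
    qed
  qed
  \<comment> \<open>The 1 keeps the constant positive, also for an empty basis, so that its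
    logarithm can be used.\<close>
  moreover have "0 < sum C B + 1"
    using C(1) sum_nonneg[of B C] by fastforce
  ultimately show ?thesis by blast
qed

lemma ln_singular_value_rate_le:
  assumes k: "k \<in> {1..CARD('n)}" "dim (lyapunov_space A l) + k > CARD('n)" and e: "0 < e"
  shows "eventually (\<lambda>t. ln (singular_value k (cauchy_matrix X t 0)) / t \<le> l + e) at_top"
proof -
  let ?E = "span (lyapunov_space A l)"
  \<comment> \<open>One half of \<open>e\<close> is spent on the exponential bound, the other
    absorbs \<open>ln C / t\<close>.\<close>
  have "0 < e / 2" using e by simp
  from uniform_lyapunov_space_bound[OF this, of l]
  obtain C where C: "0 < C" "eventually (\<lambda>t. \<forall>w\<in>?E.
      norm (cauchy_matrix X t 0 *v w) \<le> C * exp ((l + e / 2) * t) * norm w) at_top" by blast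
  have "((\<lambda>t. ln C / t) \<longlongrightarrow> 0) at_top" by real_asymp
  then have "eventually (\<lambda>t. ln C / t < e / 2) at_top"
    using e by (intro order_tendstoD(2)) auto
  then show ?thesis
    using C(2) eventually_gt_at_top[of 0]
  proof eventually_elim
    case (elim t)
    let ?Z = "cauchy_matrix X t 0"
    have Z: "invertible ?Z" using elim by (intro invertible_cauchy) auto
    have "dim ?E + card {..idx k :: 'n} > CARD('n)"
      using k by (simp add: card_atMost_idx dim_span)
    from singular_value_le_norm_on_subspace[OF Z subspace_span this]
    obtain x where x: "x \<in> ?E" "x \<noteq> 0" "singular_values ?Z $ idx k * norm x \<le> norm (?Z *v x)" by blast
    then have "singular_values ?Z $ idx k * norm x \<le> C * exp ((l + e / 2) * t) * norm x"
      using elim(2) order_trans by blast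
    then have "singular_value k ?Z \<le> C * exp ((l + e / 2) * t)"
      using x(2) by (simp add: singular_value_def)
    moreover have "0 < singular_value k ?Z"
      unfolding singular_value_def by (rule singular_values_pos[OF Z])
    ultimately have "ln (singular_value k ?Z) \<le> ln (C * exp ((l + e / 2) * t))"
      by (subst ln_le_cancel_iff) (use C(1) in auto)
    then have "ln (singular_value k ?Z) / t \<le> ln C / t + (l + e / 2)"
      using elim(3) C(1) by (simp add: ln_mult field_simps)
    then show ?case using elim(1) by linarith
  qed
qed

end

locale lyapunov_system = bounded_linear_system A X
  for A X :: "real \<Rightarrow> 'n::{finite,wellorder} mat" +
  fixes q :: nat and lam :: "nat \<Rightarrow> real" and m :: "nat \<Rightarrow> nat"
  assumes spectrum: "lyapunov_spectrum A q lam m" and regular: "lyapunov_regular X q lam m"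
begin

text \<open>The codimension of the space of solutions with exponent less than \<open>lam l\<close>.\<close>

definition codim :: "nat \<Rightarrow> nat" where "codim l = (\<Sum>j=1..l. m j)"

lemma lam_decreasing: "1 \<le> i \<Longrightarrow> i < j \<Longrightarrow> j \<le> q \<Longrightarrow> lam j < lam i"
  using spectrum by (auto simp: lyapunov_spectrum_def)

lemma lyapunov_space_top: "lyapunov_space A (lam 1) = UNIV"
proof -
  have "w \<in> lyapunov_space A (lam 1)" for w
  proof -
    let ?x = "\<lambda>t. cauchy_matrix X t 0 *v w"
    have x: "solution A ?x" "?x 0 = w"
      by (simp_all add: solution_cauchy cauchy_self)
    have "lyapunov_exponent ?x \<le> ereal (lam 1)"
    proof (cases "w = 0")
      case True
      then show ?thesis by (simp add: lyapunov_exponent_def Limsup_const)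
    next
      case False
      then have "lyapunov_exponent ?x \<in> {lyapunov_exponent x | x. solution A x \<and> (\<exists>t\<ge>0. x t \<noteq> 0)}"
        using x by (auto intro!: exI[of _ ?x] exI[of _ 0])
      then obtain i where "i \<in> {1..q}" "lyapunov_exponent ?x = ereal (lam i)"
        using spectrum unfolding lyapunov_spectrum_def by auto
      then show ?thesis
        using lam_decreasing[of 1 i] by (cases "i = 1") auto
    qed
    then show ?thesis
      using x unfolding lyapunov_space_def by (intro CollectI exI[of _ ?x]) auto
  qed
  then show ?thesis by blast
qed

lemma q_pos: "0 < q"
proof (rule ccontr)
  assume "\<not> 0 < q"
  then have *: "{lyapunov_exponent x | x. solution A x \<and> (\<exists>t\<ge>0. x t \<noteq> 0)} = {}"
    using spectrum by (simp add: lyapunov_spectrum_def)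
  have "(axis undefined 1 :: (real, 'n) vec) \<noteq> 0"
    by (simp add: axis_eq_0_iff)
  moreover have "cauchy_matrix X 0 0 *v axis undefined 1 = axis undefined 1"
    by (simp add: cauchy_self)
  ultimately have "\<exists>t\<ge>0. cauchy_matrix X t 0 *v axis undefined 1 \<noteq> 0"
    by (intro exI[of _ 0]) simp
  then show False
    using * solution_cauchy by blast
qed

lemma codim_eq:
  assumes "l < q"
  shows "codim l + dim (lyapunov_space A (lam (Suc l))) = CARD('n)"
  using assms
proof (induction l)
  case 0
  then show ?case using lyapunov_space_top by (simp add: codim_def)
next
  case (Suc l)
  \<comment> \<open>Multiplicities are truncated differences of natural numbers; the nesting of the
    spaces makes them genuine differences.\<close>
  have "lyapunov_space A (lam (Suc (Suc l))) \<subseteq> lyapunov_space A (lam (Suc l))"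
    using lam_decreasing[of "Suc l" "Suc (Suc l)"] Suc.prems
    unfolding lyapunov_space_def by (force intro: order_trans)
  then have "dim (lyapunov_space A (lam (Suc (Suc l)))) \<le> dim (lyapunov_space A (lam (Suc l)))"
    by (rule dim_subset)
  moreover have "m (Suc l) = dim (lyapunov_space A (lam (Suc l))) - dim (lyapunov_space A (lam (Suc (Suc l))))"
    using spectrum Suc.prems by (simp add: lyapunov_spectrum_def)
  ultimately show ?case
    using Suc by (simp add: codim_def)
qed

lemma codim_q: "codim q = CARD('n)"
proof -
  obtain l where l: "q = Suc l" using q_pos by (cases q) auto
  then have "m q = dim (lyapunov_space A (lam q))"
    using spectrum by (auto simp: lyapunov_spectrum_def)
  then show ?thesis
    using codim_eq[of l] l by (simp add: codim_def)
qed

lemma codim_mono: "k \<le> l \<Longrightarrow> codim k \<le> codim l"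
  unfolding codim_def by (rule sum_mono2) auto

lemma codim_le: "l \<le> q \<Longrightarrow> codim l \<le> CARD('n)"
  using codim_mono[of l q] by (simp add: codim_q)

lemma sum_over_blocks:
  fixes f :: "nat \<Rightarrow> real"
  shows "(\<Sum>i=1..l. \<Sum>k=codim (i - 1) + 1..codim i. f k) = (\<Sum>k=1..codim l. f k)"
proof (induction l)
  case (Suc l)
  have "{1..codim (Suc l)} = {1..codim l} \<union> {codim l + 1..codim (Suc l)}"
    using codim_mono[of l "Suc l"] by auto
  then have "(\<Sum>k=1..codim (Suc l). f k) = (\<Sum>k=1..codim l. f k) + (\<Sum>k=codim l + 1..codim (Suc l). f k)"
    by (simp add: sum.union_disjoint)
  then show ?case using Suc by simp
qed (simp add: codim_def)

text \<open>The space for \<open>lam j\<close> has codimension \<open>codim (j - 1)\<close>, so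
  min-max bounds the rate of every singular value in block \<open>j\<close> by \<open>lam j\<close>.
  All singular values multiply to the absolute determinant, whose lower rate is the sum of these
  bounds by regularity.\<close>

lemma block_rate_tendsto:
  assumes i: "i \<in> {1..q}"
  shows "((\<lambda>t. (\<Sum>k=codim (i - 1) + 1..codim i. ln (singular_value k (cauchy_matrix X t 0))) / t)
    \<longlongrightarrow> real (m i) * lam i) at_top"
proof (rule tendsto_of_sum_tight[where I = "{1..q}"
      and f = "\<lambda>i t. (\<Sum>k=codim (i - 1) + 1..codim i. ln (singular_value k (cauchy_matrix X t 0))) / t"
      and a = "\<lambda>i. real (m i) * lam i"])
  fix j :: nat and e :: real assume j: "j \<in> {1..q}" and e: "0 < e"
  have card: "codim j - codim (j - 1) = m j"
    using j by (cases j) (auto simp: codim_def)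
  \<comment> \<open>The tolerance \<open>e\<close> is shared among the \<open>m j\<close> singular
    values of the block; the 1 guards against division by 0.\<close>
  define d where "d = e / (real (m j) + 1)"
  have d: "0 < d" "real (m j) * d \<le> e"
    using e by (auto simp: d_def field_simps)
  have "eventually (\<lambda>t. \<forall>k\<in>{codim (j - 1) + 1..codim j}.
      ln (singular_value k (cauchy_matrix X t 0)) / t \<le> lam j + d) at_top"
  proof (intro eventually_ball_finite ballI ln_singular_value_rate_le d)
    fix k assume k: "k \<in> {codim (j - 1) + 1..codim j}"
    then show "k \<in> {1..CARD('n)}"
      using codim_le[of j] j by auto
    show "CARD('n) < dim (lyapunov_space A (lam j)) + k"
      using codim_eq[of "j - 1"] j k by (cases j) auto
  qed auto
  then show "eventually (\<lambda>t. (\<Sum>k=codim (j - 1) + 1..codim j. ln (singular_value k (cauchy_matrix X t 0))) / t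
      \<le> real (m j) * lam j + e) at_top"
  proof eventually_elim
    case (elim t)
    have "(\<Sum>k=codim (j - 1) + 1..codim j. ln (singular_value k (cauchy_matrix X t 0)) / t)
        \<le> real (card {codim (j - 1) + 1..codim j}) * (lam j + d)"
      using elim by (intro sum_bounded_above) auto
    also have "\<dots> \<le> real (m j) * lam j + e"
      using d card by (simp add: algebra_simps)
    finally show ?case by (simp add: sum_divide_distrib)
  qed
next
  fix e :: real assume e: "0 < e"
  have "eventually (\<lambda>t. ereal ((\<Sum>i=1..q. real (m i) * lam i) - e / 2) < ereal (ln \<bar>det (X t)\<bar> / t)) at_top"
  proof -
    have "ereal (\<Sum>i=1..q. real (m i) * lam i) \<le> Liminf at_top (\<lambda>t. ereal (ln \<bar>det (X t)\<bar> / t))"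
      using regular unfolding lyapunov_regular_def by (rule eq_refl)
    moreover have "ereal ((\<Sum>i=1..q. real (m i) * lam i) - e / 2) < ereal (\<Sum>i=1..q. real (m i) * lam i)"
      using e by simp
    ultimately show ?thesis
      unfolding le_Liminf_iff by blast
  qed
  moreover have "((\<lambda>t. ln \<bar>det (X 0)\<bar> / t) \<longlongrightarrow> 0) at_top" by real_asymp
  then have "eventually (\<lambda>t. ln \<bar>det (X 0)\<bar> / t < e / 2) at_top"
    using e by (intro order_tendstoD(2)) auto
  ultimately show "eventually (\<lambda>t. (\<Sum>i=1..q. real (m i) * lam i) - e \<le>
    (\<Sum>i=1..q. (\<Sum>k=codim (i - 1) + 1..codim i. ln (singular_value k (cauchy_matrix X t 0))) / t)) at_top"
    using eventually_gt_at_top[of 0]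
  proof eventually_elim
    case (elim t)
    let ?Z = "cauchy_matrix X t 0"
    have Z: "invertible ?Z" using elim by (intro invertible_cauchy) auto
    have "(\<Sum>i=1..q. (\<Sum>k=codim (i - 1) + 1..codim i. ln (singular_value k ?Z))) = (\<Sum>k=1..CARD('n). ln (singular_value k ?Z))"
      using sum_over_blocks[of "\<lambda>k. ln (singular_value k ?Z)" q] by (simp add: codim_q)
    also have "\<dots> = (\<Sum>i\<in>UNIV. ln (singular_values ?Z $ i))"
      unfolding singular_value_def
      using sum.reindex_bij_betw[OF bij_betw_idx[where 'n = 'n], of "\<lambda>i. ln (singular_values ?Z $ i)"] .
    also have "\<dots> = ln \<bar>det ?Z\<bar>"
      unfolding abs_det_singular_values[OF Z]
      by (rule ln_prod[symmetric]) (use singular_values_pos[OF Z] in \<open>auto simp: less_imp_neq[symmetric]\<close>)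
    also have "\<bar>det ?Z\<bar> = \<bar>det (X t)\<bar> / \<bar>det (X 0)\<bar>"
    proof -
      have "?Z ** X 0 = X t"
        unfolding cauchy_matrix_def by (simp add: X_inv flip: matrix_mul_assoc)
      then have "\<bar>det ?Z\<bar> * \<bar>det (X 0)\<bar> = \<bar>det (X t)\<bar>"
        by (metis abs_mult det_mul)
      then show ?thesis
        using invertible_X[of 0] by (simp add: field_simps invertible_det_nz)
    qed
    also have "ln \<dots> = ln \<bar>det (X t)\<bar> - ln \<bar>det (X 0)\<bar>"
      using invertible_X[of 0] invertible_X[of t] elim by (simp add: ln_div invertible_det_nz)
    finally have "(\<Sum>i=1..q. (\<Sum>k=codim (i - 1) + 1..codim i. ln (singular_value k ?Z)) / t)
        = ln \<bar>det (X t)\<bar> / t - ln \<bar>det (X 0)\<bar> / t"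
      by (simp add: diff_divide_distrib flip: sum_divide_distrib)
    then show ?case using elim by simp
  qed
qed (use i in auto)

lemma gain_rate_tendsto:
  assumes l: "l \<le> q"
  shows "((\<lambda>t. ln (gain (idx ` {1..codim l}) (cauchy_matrix X t 0)) / t)
    \<longlongrightarrow> (\<Sum>i=1..l. real (m i) * lam i)) at_top"
proof (rule Lim_transform_eventually)
  show "((\<lambda>t. \<Sum>i=1..l. (\<Sum>k=codim (i - 1) + 1..codim i. ln (singular_value k (cauchy_matrix X t 0))) / t)
    \<longlongrightarrow> (\<Sum>i=1..l. real (m i) * lam i)) at_top"
    using l by (intro tendsto_sum block_rate_tendsto) auto
  show "eventually (\<lambda>t. (\<Sum>i=1..l. (\<Sum>k=codim (i - 1) + 1..codim i. ln (singular_value k (cauchy_matrix X t 0))) / t)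
      = ln (gain (idx ` {1..codim l}) (cauchy_matrix X t 0)) / t) at_top"
    using eventually_gt_at_top[of 0]
  proof eventually_elim
    case (elim t)
    let ?Z = "cauchy_matrix X t 0"
    have Z: "invertible ?Z" using elim by (intro invertible_cauchy) auto
    have "gain (idx ` {1..codim l}) ?Z = (\<Prod>k=1..codim l. singular_value k ?Z)"
      by (rule prod_singular_value_eq_gain[OF codim_le[OF l], symmetric])
    also have "ln \<dots> = (\<Sum>k=1..codim l. ln (singular_value k ?Z))"
      by (rule ln_prod) (use singular_values_pos[OF Z] in \<open>auto simp: singular_value_def less_imp_neq[symmetric]\<close>)
    finally show ?case
      by (simp only: sum_over_blocks flip: sum_divide_distrib)
  qed
qed

end

section \<open>Perturbation by the one-step method\<close>

context bounded_linear_system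
begin

text \<open>Backward time is included because the error estimate compares the gain at the start of a
  step with that at its end.\<close>

lemma gain_short_step_bounded:
  "\<exists>K>0. \<forall>s\<ge>0. \<forall>t\<ge>0. \<bar>t - s\<bar> \<le> d \<longrightarrow> gain S (cauchy_matrix X t s) \<le> K"
proof -
  define B where "B = exp (growth * \<bar>d\<bar>)"
  have B: "1 \<le> B" using growth(1) by (simp add: B_def)
  let ?K = "real CARD('n \<Rightarrow> 'n) * real CARD('n \<Rightarrow> 'n) * B ^ CARD('n)"
  have "gain S (cauchy_matrix X t s) \<le> ?K" if st: "0 \<le> s" "0 \<le> t" "\<bar>t - s\<bar> \<le> d" for s t
  proof (rule gain_le)
    show "invertible (cauchy_matrix X t s)" using st by (intro invertible_cauchy)
    have "\<bar>cauchy_matrix X t s $ i $ j\<bar> \<le> B" for i j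
      unfolding B_def by (intro abs_component_le norm_cauchy_le) (use st in auto)
    then show "norm (tensor_pow S (cauchy_matrix X t s) *v T) \<le> ?K * norm T" for T
      using B by (intro norm_matrix_vector_mult_le abs_tensor_pow_le)
  qed
  moreover have "0 < ?K" using B by simp
  ultimately show ?thesis by blast
qed

lemma tensor_pow_local_error:
  assumes cons: "consistent_of_order X hmax \<Phi> p" and p: "0 < p"
  shows "\<exists>c\<ge>0. \<forall>t\<ge>0. \<forall>h\<in>{0..hmax}. \<forall>T.
    norm (tensor_pow S (\<Phi> t h) *v T - tensor_pow S (cauchy_matrix X (t + h) t) *v T) \<le> c * h powr (p + 1) * norm T"
proof -
  obtain c where c: "0 < c" "\<And>t h. 0 \<le> t \<Longrightarrow> h \<in> {0..hmax} \<Longrightarrow>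
      onorm ((*v) (\<Phi> t h - cauchy_matrix X (t + h) t)) \<le> c * h powr (p + 1)"
    using cons unfolding consistent_of_order_def by blast
  \<comment> \<open>A bound for the entries of the exact step, plus the largest local error so that
    it also bounds those of the method.\<close>
  define B where "B = exp (growth * \<bar>hmax\<bar>) + c * \<bar>hmax\<bar> powr (p + 1)"
  have e1: "1 \<le> exp (growth * \<bar>hmax\<bar>)" using growth(1) by simp
  moreover have c0: "0 \<le> c * \<bar>hmax\<bar> powr (p + 1)" using c(1) by simp
  ultimately have B: "1 \<le> B" unfolding B_def by linarith
  let ?c = "(real CARD('n \<Rightarrow> 'n) * real CARD('n \<Rightarrow> 'n) * (real CARD('n) * B ^ CARD('n))) * c"
  have "norm (tensor_pow S (\<Phi> t h) *v T - tensor_pow S (cauchy_matrix X (t + h) t) *v T) \<le> ?c * h powr (p + 1) * norm T"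
    if t: "0 \<le> t" and h: "h \<in> {0..hmax}" for t h T
  proof -
    have Z: "\<bar>cauchy_matrix X (t + h) t $ i $ j\<bar> \<le> exp (growth * \<bar>hmax\<bar>)" for i j
      by (intro abs_component_le norm_cauchy_le) (use t h in auto)
    have D: "\<bar>\<Phi> t h $ i $ j - cauchy_matrix X (t + h) t $ i $ j\<bar> \<le> c * h powr (p + 1)" for i j
      using matrix_component_le_onorm[of "\<Phi> t h - cauchy_matrix X (t + h) t" i j] c(2)[OF t h] by simp
    have "c * h powr (p + 1) \<le> c * \<bar>hmax\<bar> powr (p + 1)"
      using h p c(1) by (intro mult_left_mono powr_mono2) auto
    then have P: "\<bar>\<Phi> t h $ i $ j\<bar> \<le> B" for i j
      using Z[of i j] D[of i j] unfolding B_def by linarith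
    have Z': "\<bar>cauchy_matrix X (t + h) t $ i $ j\<bar> \<le> B" for i j
      using Z[of i j] c0 unfolding B_def by linarith
    from tensor_pow_diff_le[OF P Z' B D, of S T] show ?thesis
      by (simp add: mult_ac)
  qed
  moreover have "0 \<le> ?c" using B c(1) by simp
  ultimately show ?thesis by blast
qed

text \<open>The error after \<open>n\<close> steps is estimated after transport to every later time \<open>t\<close>. Strong fast
  invertibility makes the gain of the composed transports comparable to the gain from \<open>0\<close> to \<open>t\<close>, so
  each step contributes an amount proportional to its local error.\<close>

lemma method_flow_error:
  assumes S: "initial_segment S" and T: "alternating S T"
    and C: "\<And>r s t. 0 \<le> r \<Longrightarrow> r \<le> s \<Longrightarrow> s \<le> t \<Longrightarrow>
      gain S (cauchy_matrix X t s) * gain S (cauchy_matrix X s r) \<le> C * gain S (cauchy_matrix X t r)" "0 \<le> C"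
    and K: "\<And>s t. 0 \<le> s \<Longrightarrow> 0 \<le> t \<Longrightarrow> \<bar>t - s\<bar> \<le> hmax \<Longrightarrow> gain S (cauchy_matrix X t s) \<le> K" "0 \<le> K"
    and c: "\<And>t h T. 0 \<le> t \<Longrightarrow> h \<in> {0..hmax} \<Longrightarrow>
      norm (tensor_pow S (\<Phi> t h) *v T - tensor_pow S (cauchy_matrix X (t + h) t) *v T) \<le> c * h powr (p + 1) * norm T"
      "0 \<le> c"
    and h: "\<And>n. n \<ge> 1 \<Longrightarrow> 0 < h n \<and> h n \<le> hmax"
    and small: "\<And>n. 2 * C * K * c * norm T * (\<Sum>j<n. h (Suc j) powr (p + 1)) \<le> norm T"
    and t: "grid h n \<le> t"
  shows "norm (tensor_pow S (cauchy_matrix X t (grid h n)) *v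
      (tensor_pow S (method_flow \<Phi> h n) *v T - tensor_pow S (cauchy_matrix X (grid h n) 0) *v T))
    \<le> 2 * C * K * c * norm T * (\<Sum>j<n. h (Suc j) powr (p + 1)) * gain S (cauchy_matrix X t 0)"
  using t
proof (induction n arbitrary: t)
  case 0
  have "grid h 0 = 0" by (simp add: grid_def)
  then show ?case by (simp add: cauchy_self)
next
  case (Suc n)
  let ?X = "cauchy_matrix X" and ?a = "grid h n" and ?b = "grid h (Suc n)"
  let ?Y = "tensor_pow S (method_flow \<Phi> h n) *v T" and ?Z = "tensor_pow S (?X ?a 0) *v T"
  have a: "0 \<le> ?a" unfolding grid_def using h by (intro sum_nonneg) (simp add: less_imp_le)
  have ab: "?b = ?a + h (Suc n)" by (simp add: grid_def)
  have hn: "0 < h (Suc n)" "h (Suc n) \<le> hmax" using h[of "Suc n"] by auto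
  have g: "0 < gain S (?X s r)" if "0 \<le> r" "0 \<le> s" for r s
    using that by (intro gain_pos invertible_cauchy)
  let ?E = "tensor_pow S (\<Phi> ?a (h (Suc n))) *v ?Y - tensor_pow S (?X ?b ?a) *v ?Y"
  let ?\<kappa> = "2 * C * K * c * norm T"
  have Y: "alternating S ?Y" using T by (rule alternating_tensor_pow)
  \<comment> \<open>At \<open>t = grid h n\<close> the transport is the identity, so the induction
    hypothesis bounds the error itself. By \<open>small\<close> it is at most \<open>norm T\<close>
    times the gain, which gives the factor 2 for \<open>?Y\<close> and keeps the recursion
    additive.\<close>
  have "norm (?Y - ?Z) \<le> ?\<kappa> * (\<Sum>j<n. h (Suc j) powr (p + 1)) * gain S (?X ?a 0)"
    using Suc.IH[of ?a] a by (simp add: cauchy_self tensor_pow_mat1)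
  also have "\<dots> \<le> norm T * gain S (?X ?a 0)"
    using g[of 0 ?a] a by (intro mult_right_mono small) auto
  finally have Yn: "norm ?Y \<le> 2 * norm T * gain S (?X ?a 0)"
    using norm_triangle_ineq[of ?Z "?Y - ?Z"] norm_tensor_pow_le_gain[OF invertible_cauchy[of 0 ?a] S T] a
    by (simp add: mult.commute)
  have "norm ?E \<le> c * h (Suc n) powr (p + 1) * norm ?Y"
    unfolding ab using a hn by (intro c) auto
  then have E: "norm ?E \<le> c * h (Suc n) powr (p + 1) * (2 * norm T * gain S (?X ?a 0))"
    by (rule order_trans[OF _ mult_left_mono[OF Yn]]) (use c(2) in auto)
  \<comment> \<open>The local error is measured by the gain up to the start of the step but
    transported from its end. Going back one step costs \<open>K\<close>; fast invertibility then
    applies at the common time \<open>?b\<close>.\<close>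
  have "?X ?a 0 = ?X ?a ?b ** ?X ?b 0" using a ab hn by (intro cauchy_cocycle) auto
  then have "gain S (?X ?a 0) \<le> gain S (?X ?a ?b) * gain S (?X ?b 0)"
    using a ab hn S by (metis add_increasing gain_mult_le invertible_cauchy less_imp_le order_refl)
  also have "\<dots> \<le> K * gain S (?X ?b 0)"
    using a ab hn g[of 0 ?b] by (intro mult_right_mono K) auto
  finally have "gain S (?X t ?b) * gain S (?X ?a 0) \<le> gain S (?X t ?b) * (K * gain S (?X ?b 0))"
    using g[of ?b t] a ab hn Suc.prems by (intro mult_left_mono) auto
  also have "\<dots> = K * (gain S (?X t ?b) * gain S (?X ?b 0))" by simp
  also have "\<dots> \<le> K * (C * gain S (?X t 0))"
    using a ab hn Suc.prems K(2) by (intro mult_left_mono C) auto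
  finally have tr: "gain S (?X t ?b) * gain S (?X ?a 0) \<le> K * (C * gain S (?X t 0))" .
  have X1: "?X t ?a = ?X t ?b ** ?X ?b ?a" and X2: "?X ?b 0 = ?X ?b ?a ** ?X ?a 0"
    using a ab hn by (auto intro: cauchy_cocycle)
  have "tensor_pow S (method_flow \<Phi> h (Suc n)) *v T - tensor_pow S (?X ?b 0) *v T =
      ?E + tensor_pow S (?X ?b ?a) *v (?Y - ?Z)"
    by (simp add: X2 tensor_pow_mult matrix_vector_mul_assoc[symmetric] matrix_vector_mult_diff_distrib)
  then have eq: "tensor_pow S (?X t ?b) *v (tensor_pow S (method_flow \<Phi> h (Suc n)) *v T - tensor_pow S (?X ?b 0) *v T)
      = tensor_pow S (?X t ?b) *v ?E + tensor_pow S (?X t ?a) *v (?Y - ?Z)"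
    by (simp only: X1 tensor_pow_mult matrix_vector_mul_assoc[symmetric] matrix_vector_right_distrib)
  have old: "norm (tensor_pow S (?X t ?a) *v (?Y - ?Z))
      \<le> ?\<kappa> * (\<Sum>j<n. h (Suc j) powr (p + 1)) * gain S (?X t 0)"
    using Suc.prems ab hn by (intro Suc.IH) auto
  have new: "norm (tensor_pow S (?X t ?b) *v ?E) \<le> ?\<kappa> * h (Suc n) powr (p + 1) * gain S (?X t 0)"
  proof -
    have "alternating S ?E"
      using alternating_tensor_pow[OF Y, of "\<Phi> ?a (h (Suc n))"] alternating_tensor_pow[OF Y, of "?X ?b ?a"]
      by (simp add: alternating_def algebra_simps)
    then have "norm (tensor_pow S (?X t ?b) *v ?E) \<le> gain S (?X t ?b) * norm ?E"
      using a ab hn Suc.prems by (intro norm_tensor_pow_le_gain invertible_cauchy S) auto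
    also have "\<dots> \<le> gain S (?X t ?b) * (c * h (Suc n) powr (p + 1) * (2 * norm T * gain S (?X ?a 0)))"
      using E g[of ?b t] a ab hn Suc.prems by (intro mult_left_mono) auto
    also have "\<dots> = 2 * c * norm T * h (Suc n) powr (p + 1) * (gain S (?X t ?b) * gain S (?X ?a 0))"
      by simp
    also have "\<dots> \<le> 2 * c * norm T * h (Suc n) powr (p + 1) * (K * (C * gain S (?X t 0)))"
      using c(2) by (intro mult_left_mono tr) auto
    finally show ?thesis by (simp add: mult_ac)
  qed
  have "norm (tensor_pow S (?X t ?b) *v ?E + tensor_pow S (?X t ?a) *v (?Y - ?Z))
      \<le> ?\<kappa> * h (Suc n) powr (p + 1) * gain S (?X t 0)
        + ?\<kappa> * (\<Sum>j<n. h (Suc j) powr (p + 1)) * gain S (?X t 0)"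
    by (rule norm_triangle_le[OF add_mono[OF new old]])
  also have "\<dots> = ?\<kappa> * (\<Sum>j<Suc n. h (Suc j) powr (p + 1)) * gain S (?X t 0)"
    by (simp add: algebra_simps)
  finally show ?case unfolding eq .
qed

lemma strongly_fast_invertible_gain:
  assumes "strongly_fast_invertible X L" and L: "L \<le> CARD('n)"
  defines "S \<equiv> idx ` {1..L} :: 'n set"
  shows "\<exists>C>0. \<forall>r s t. 0 \<le> r \<and> r \<le> s \<and> s \<le> t \<longrightarrow>
    gain S (cauchy_matrix X t s) * gain S (cauchy_matrix X s r) \<le> C * gain S (cauchy_matrix X t r)"
proof -
  obtain C where C: "\<And>r s t. 0 \<le> r \<Longrightarrow> r \<le> s \<Longrightarrow> s \<le> t \<Longrightarrow>
    (\<Prod>k=1..L. singular_value k (cauchy_matrix X t s) * singular_value k (cauchy_matrix X s r)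
      / singular_value k (cauchy_matrix X t r)) \<le> C"
    using assms(1) unfolding strongly_fast_invertible_def bdd_above_def by blast
  have "gain S (cauchy_matrix X t s) * gain S (cauchy_matrix X s r) \<le> max C 1 * gain S (cauchy_matrix X t r)"
    if "0 \<le> r \<and> r \<le> s \<and> s \<le> t" for r s t
  proof -
    have "gain S (cauchy_matrix X t s) * gain S (cauchy_matrix X s r) / gain S (cauchy_matrix X t r) \<le> C"
      using C[of r s t] that
      by (simp only: prod_dividef prod.distrib prod_singular_value_eq_gain[OF L] S_def)
    then have "gain S (cauchy_matrix X t s) * gain S (cauchy_matrix X s r) / gain S (cauchy_matrix X t r) \<le> max C 1"
      by simp
    moreover have "0 < gain S (cauchy_matrix X t r)"
      using that by (intro gain_pos invertible_cauchy) auto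
    ultimately show ?thesis by (simp only: pos_divide_le_eq)
  qed
  then show ?thesis by (intro exI[of _ "max C 1"]) auto
qed

end

context lyapunov_system
begin

text \<open>Both the null set and \<open>\<epsilon>\<close> depend on the order
  \<open>codim l\<close>; there are only finitely many \<open>l\<close> to combine.\<close>

lemma AE_sum_benettin_output_tendsto:
  assumes l: "l \<in> {1..q}"
    and sfi: "strongly_fast_invertible X (codim l)"
    and scheme: "one_step_method hmax \<Phi>" "consistent_of_order X hmax \<Phi> p" "0 < p"
  shows "AE v in (lebesgue :: 'n mat measure). \<exists>\<epsilon>>0. \<forall>h :: nat \<Rightarrow> real.
      (\<forall>n\<ge>1. 0 < h n \<and> h n \<le> hmax) \<longrightarrow>
      filterlim (grid h) at_top sequentially \<longrightarrow>
      summable (\<lambda>n. h (Suc n) powr (p + 1)) \<longrightarrow>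
      (\<Sum>n. h (Suc n) powr (p + 1)) < \<epsilon> \<longrightarrow>
      (\<lambda>n. \<Sum>k=1..codim l. benettin_output \<Phi> h (transpose v) k n) \<longlonglongrightarrow> (\<Sum>i=1..l. real (m i) * lam i)"
proof -
  define S where "S = (idx ` {1..codim l} :: 'n set)"
  have L: "codim l \<le> CARD('n)" using l by (intro codim_le) auto
  have S: "initial_segment S" unfolding S_def using L by (rule initial_segment_idx)
  let ?Z = "\<lambda>t. cauchy_matrix X t 0"
  obtain C where C: "0 < C" "\<And>r s t. 0 \<le> r \<Longrightarrow> r \<le> s \<Longrightarrow> s \<le> t \<Longrightarrow>
      gain S (cauchy_matrix X t s) * gain S (cauchy_matrix X s r) \<le> C * gain S (cauchy_matrix X t r)"
    using strongly_fast_invertible_gain[OF sfi L] unfolding S_def by blast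
  obtain K where K: "0 < K" "\<And>s t. 0 \<le> s \<Longrightarrow> 0 \<le> t \<Longrightarrow> \<bar>t - s\<bar> \<le> hmax \<Longrightarrow> gain S (cauchy_matrix X t s) \<le> K"
    using gain_short_step_bounded[of hmax S] by blast
  obtain c where c: "0 \<le> c" "\<And>t h T. 0 \<le> t \<Longrightarrow> h \<in> {0..hmax} \<Longrightarrow>
      norm (tensor_pow S (\<Phi> t h) *v T - tensor_pow S (cauchy_matrix X (t + h) t) *v T) \<le> c * h powr (p + 1) * norm T"
    using tensor_pow_local_error[OF scheme(2,3), of S] by blast
  have "AE v in lebesgue. \<exists>\<eta>>0. \<forall>t\<ge>0. \<eta> * gain S (?Z t) \<le> norm (tensor_pow S (?Z t ** transpose v) *v wedge_basis S)"
    using C by (intro AE_wedge_grows_like_gain[where W = "cauchy_matrix X" and C = C] S invertible_cauchy cauchy_cocycle) auto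
  then show ?thesis
    using AE_invertible
  proof eventually_elim
    case (elim v)
    define T where "T = tensor_pow S (transpose v) *v wedge_basis S"
    have T: "alternating S T"
      unfolding T_def by (intro alternating_tensor_pow alternating_wedge_basis)
    obtain \<eta> where \<eta>: "0 < \<eta>" "\<And>t. 0 \<le> t \<Longrightarrow> \<eta> * gain S (?Z t) \<le> norm (tensor_pow S (?Z t) *v T)"
      using elim(1) by (auto simp: T_def tensor_pow_mult matrix_vector_mul_assoc)
    have g: "0 < gain S (?Z t)" if "0 \<le> t" for t
      using that by (intro gain_pos invertible_cauchy) auto
    \<comment> \<open>Upper and lower bound are compared at time 0. This turns an error of at most
      \<open>\<eta> / 2\<close> into the smallness hypothesis of the error estimate.\<close>
    have \<eta>T: "\<eta> \<le> norm T"
      using \<eta>(2)[of 0] norm_tensor_pow_le_gain[OF invertible_cauchy[of 0 0] S T] g[of 0]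
      by (simp add: mult.commute[of \<eta>] order_trans mult_le_cancel_left_pos)
        (meson mult_le_cancel_left_pos order_trans)
    define \<kappa> where "\<kappa> = 2 * C * K * c * norm T"
    have \<kappa>: "0 \<le> \<kappa>" using C K c by (simp add: \<kappa>_def)
    \<comment> \<open>Chosen so that the accumulated error, \<open>\<kappa>\<close> times the sum of
      the local errors, is at most half of the lower bound \<open>\<eta>\<close>; the 1 allows
      \<open>\<kappa> = 0\<close>.\<close>
    define \<epsilon> where "\<epsilon> = \<eta> / (2 * (\<kappa> + 1))"
    have \<epsilon>: "0 < \<epsilon>" "\<kappa> * \<epsilon> \<le> \<eta> / 2"
      using \<eta>(1) \<kappa> by (auto simp: \<epsilon>_def field_simps)
    have "(\<lambda>n. \<Sum>k=1..codim l. benettin_output \<Phi> h (transpose v) k n) \<longlonglongrightarrow> (\<Sum>i=1..l. real (m i) * lam i)"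
      if h: "\<forall>n\<ge>1. 0 < h n \<and> h n \<le> hmax" and grid: "filterlim (grid h) at_top sequentially"
        and sum: "summable (\<lambda>n. h (Suc n) powr (p + 1))" "(\<Sum>n. h (Suc n) powr (p + 1)) < \<epsilon>" for h
    proof -
      have grid0: "0 \<le> grid h n" for n
        unfolding grid_def using h by (intro sum_nonneg) (simp add: less_imp_le)
      have part: "\<kappa> * (\<Sum>j<n. h (Suc j) powr (p + 1)) \<le> \<eta> / 2" for n
      proof -
        have "(\<Sum>j<n. h (Suc j) powr (p + 1)) \<le> \<epsilon>"
          using sum_le_suminf[OF sum(1), of "{..<n}"] sum(2) by fastforce
        then show ?thesis using \<kappa> \<epsilon>(2) mult_left_mono order_trans by blast
      qed
      have inv: "invertible (\<Phi> (grid h n) (h (Suc n)))" for n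
        using scheme(1) grid0 h unfolding one_step_method_def by (simp add: less_imp_le)
      let ?Y = "\<lambda>n. tensor_pow S (method_flow \<Phi> h n) *v T" and ?G = "\<lambda>n. gain S (?Z (grid h n))"
      have G: "0 < ?G n" for n using grid0 by (rule g)
      have err: "norm (?Y n - tensor_pow S (?Z (grid h n)) *v T) \<le> \<eta> / 2 * ?G n" for n
      proof -
        have "norm (tensor_pow S (cauchy_matrix X (grid h n) (grid h n)) *v (?Y n - tensor_pow S (?Z (grid h n)) *v T))
            \<le> 2 * C * K * c * norm T * (\<Sum>j<n. h (Suc j) powr (p + 1)) * ?G n"
        proof (rule method_flow_error[OF S T C(2) _ K(2) _ c(2) c(1)])
          show "2 * C * K * c * norm T * (\<Sum>j<n. h (Suc j) powr (p + 1)) \<le> norm T" for n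
            using part[of n] \<eta>T \<eta>(1) by (simp add: \<kappa>_def)
        qed (use C K h in auto)
        also have "\<dots> \<le> \<eta> / 2 * ?G n"
          using part[of n] G[of n] by (intro mult_right_mono) (auto simp: \<kappa>_def)
        finally show ?thesis by (simp add: cauchy_self grid0 tensor_pow_mat1)
      qed
      have low: "\<eta> / 2 * ?G n \<le> norm (?Y n)" for n
        using err[of n] \<eta>(2)[OF grid0[of n]]
          norm_triangle_sub[of "tensor_pow S (?Z (grid h n)) *v T" "?Y n"]
        by (simp add: norm_minus_commute)
      have up: "norm (?Y n) \<le> 2 * norm T * ?G n" for n
      proof -
        have "norm (?Y n) \<le> norm T * ?G n + \<eta> / 2 * ?G n"
          using err[of n] norm_triangle_sub[of "?Y n" "tensor_pow S (?Z (grid h n)) *v T"]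
            norm_tensor_pow_le_gain[OF invertible_cauchy[of 0 "grid h n"] S T] grid0[of n]
          by (simp add: mult.commute)
        also have "\<eta> / 2 * ?G n \<le> norm T * ?G n"
          using \<eta>T \<eta>(1) G[of n] by (intro mult_right_mono) auto
        finally show ?thesis by simp
      qed
      \<comment> \<open>Computed volume and gain differ by bounded factors only; \<open>b\<close>
        bounds the logarithms and disappears after division by \<open>grid h n\<close>.\<close>
      define b where "b = \<bar>ln (\<eta> / 2)\<bar> + \<bar>ln (2 * norm T)\<bar> + \<bar>ln (norm (wedge_basis S))\<bar>"
      have T0: "0 < norm T" using \<eta>T \<eta>(1) by linarith
      have diff: "\<bar>ln (norm (?Y n)) - ln (norm (wedge_basis S)) - ln (?G n)\<bar> \<le> b" for n
      proof -
        have "0 < norm (?Y n)" using low[of n] G[of n] \<eta>(1) by (meson half_gt_zero mult_pos_pos order_less_le_trans)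
        then have "ln (\<eta> / 2 * ?G n) \<le> ln (norm (?Y n))" "ln (norm (?Y n)) \<le> ln (2 * norm T * ?G n)"
          using low[of n] up[of n] G[of n] \<eta>(1) T0 by (auto simp del: zero_less_norm_iff)
        moreover have "ln (\<eta> / 2 * ?G n) = ln (\<eta> / 2) + ln (?G n)" "ln (2 * norm T * ?G n) = ln (2 * norm T) + ln (?G n)"
          by ((rule ln_mult_pos; use G[of n] \<eta>(1) T0 in simp)+)
        ultimately show ?thesis unfolding b_def by linarith
      qed
      have "(\<lambda>n. ln (?G n) / grid h n) \<longlonglongrightarrow> (\<Sum>i=1..l. real (m i) * lam i)"
        using filterlim_compose[OF gain_rate_tendsto grid] l unfolding S_def by auto
      moreover have "(\<lambda>n. (ln (norm (?Y n)) - ln (norm (wedge_basis S)) - ln (?G n)) / grid h n) \<longlonglongrightarrow> 0"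
      proof (rule Lim_null_comparison)
        show "(\<lambda>n. b / grid h n) \<longlonglongrightarrow> 0"
          using grid by (intro tendsto_divide_0[OF tendsto_const] filterlim_at_top_imp_at_infinity)
        show "eventually (\<lambda>n. norm ((ln (norm (?Y n)) - ln (norm (wedge_basis S)) - ln (?G n)) / grid h n) \<le> b / grid h n) sequentially"
          using diff grid0 by (intro always_eventually allI) (simp add: divide_right_mono)
      qed
      ultimately have "(\<lambda>n. ln (?G n) / grid h n + (ln (norm (?Y n)) - ln (norm (wedge_basis S)) - ln (?G n)) / grid h n)
          \<longlonglongrightarrow> (\<Sum>i=1..l. real (m i) * lam i) + 0"
        by (rule tendsto_add)
      then have lim: "(\<lambda>n. (ln (norm (?Y n)) - ln (norm (wedge_basis S))) / grid h n) \<longlonglongrightarrow> (\<Sum>i=1..l. real (m i) * lam i)"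
        by (simp add: add_divide_distrib[symmetric])
      show ?thesis
      proof (rule Lim_transform_eventually[OF lim])
        show "eventually (\<lambda>n. (ln (norm (?Y n)) - ln (norm (wedge_basis S))) / grid h n =
          (\<Sum>k=1..codim l. benettin_output \<Phi> h (transpose v) k n)) sequentially"
          using eventually_gt_at_top[of 0]
        proof eventually_elim
          case (elim n)
          have "?Y n = tensor_pow S (method_flow \<Phi> h n ** transpose v) *v wedge_basis S"
            by (simp only: T_def tensor_pow_mult matrix_vector_mul_assoc)
          then show ?case
            using sum_benettin_output[of "transpose v" \<Phi> h "codim l" n, OF \<open>invertible (transpose v)\<close> inv L elim]
            by (simp only: S_def)
        qed
      qed
    qed
    then show ?case using \<epsilon>(1) by blast
  qed
qed

end

theorem corollary4p14:
  fixes A X :: "real \<Rightarrow> 'n::{finite,wellorder} mat"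
    and q :: nat and lam :: "nat \<Rightarrow> real" and m :: "nat \<Rightarrow> nat"
    and \<Phi> :: "real \<Rightarrow> real \<Rightarrow> 'n mat" and hmax p :: real
  assumes "continuous_on {0..} A"
    and "bounded (A ` {0..})"
    and "fundamental_matrix A X"
    and "lyapunov_spectrum A q lam m"
    and "lyapunov_regular X q lam m"
    and "\<And>l. l \<in> {1..q} \<Longrightarrow> strongly_fast_invertible X (\<Sum>j=1..l. m j)"
    and "0 < hmax"
    and "one_step_method hmax \<Phi>"
    and "0 < p"
    and "consistent_of_order X hmax \<Phi> p"
  shows "AE v in (lebesgue :: 'n mat measure).
    \<exists>\<epsilon>>0. \<forall>h :: nat \<Rightarrow> real.
      (\<forall>n\<ge>1. 0 < h n \<and> h n \<le> hmax) \<longrightarrow>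
      filterlim (grid h) at_top sequentially \<longrightarrow>
      summable (\<lambda>n. h (Suc n) powr (p + 1)) \<longrightarrow>
      (\<Sum>n. h (Suc n) powr (p + 1)) < \<epsilon> \<longrightarrow>
        (\<forall>i\<in>{1..q}.
          (\<lambda>n. \<Sum>k = (\<Sum>j=1..i - 1. m j) + 1..(\<Sum>j=1..i. m j).
                 benettin_output \<Phi> h (transpose v) k n)
            \<longlonglongrightarrow> real (m i) * lam i) \<and>
        ((\<forall>i\<in>{1..q}. m i = 1) \<longrightarrow>
          (\<forall>i\<in>{1..q}. benettin_output \<Phi> h (transpose v) i \<longlonglongrightarrow> lam i))"
proof -
  interpret lyapunov_system A X q lam m
    using assms by unfold_locales
  let ?steps = "\<lambda>h \<epsilon>. (\<forall>n\<ge>1. 0 < h n \<and> h n \<le> hmax) \<and> filterlim (grid h) at_top sequentially \<and>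
    summable (\<lambda>n. h (Suc n) powr (p + 1)) \<and> (\<Sum>n. h (Suc n) powr (p + 1)) < \<epsilon>"
  let ?lim = "\<lambda>v h l. (\<lambda>n. \<Sum>k=1..codim l. benettin_output \<Phi> h (transpose v) k n)
    \<longlonglongrightarrow> (\<Sum>i=1..l. real (m i) * lam i)"
  have "AE v in (lebesgue :: 'n mat measure). \<exists>\<epsilon>>0. \<forall>h. ?steps h \<epsilon> \<longrightarrow> ?lim v h l" if l: "l \<in> {1..q}" for l
    using AE_sum_benettin_output_tendsto[OF l _ assms(8,10,9)] assms(6)[OF l]
    by (simp add: codim_def imp_conjL)
  then have "AE v in (lebesgue :: 'n mat measure). \<forall>l\<in>{1..q}. \<exists>\<epsilon>>0. \<forall>h. ?steps h \<epsilon> \<longrightarrow> ?lim v h l"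
    by (intro AE_finite_allI) auto
  then show ?thesis
  proof eventually_elim
    case (elim v)
    then have "\<exists>e. \<forall>l\<in>{1..q}. 0 < e l \<and> (\<forall>h. ?steps h (e l) \<longrightarrow> ?lim v h l)"
      by (rule bchoice)
    then obtain e where e': "\<forall>l\<in>{1..q}. 0 < e l \<and> (\<forall>h. ?steps h (e l) \<longrightarrow> ?lim v h l)" ..
    have e: "0 < e l" "?steps h (e l) \<Longrightarrow> ?lim v h l" if "l \<in> {1..q}" for l h
      using bspec[OF e' that] by simp_all
    define \<epsilon> where "\<epsilon> = Min (e ` {1..q})"
    have \<epsilon>: "0 < \<epsilon>" "\<And>l. l \<in> {1..q} \<Longrightarrow> \<epsilon> \<le> e l"
      using e(1) q_pos by (auto simp: \<epsilon>_def)
    have block: "(\<lambda>n. \<Sum>k=codim (i - 1) + 1..codim i. benettin_output \<Phi> h (transpose v) k n) \<longlonglongrightarrow> real (m i) * lam i"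
      if h: "?steps h \<epsilon>" and i: "i \<in> {1..q}" for h i
    proof -
      have lim: "?lim v h l" if "l \<le> q" for l
      proof (cases "l = 0")
        case False
        then have l: "l \<in> {1..q}" using that by simp
        have "?steps h (e l)" using h \<epsilon>(2)[OF l] by auto
        then show ?thesis by (rule e(2)[OF l])
      qed (simp add: codim_def)
      \<comment> \<open>A block is the difference of the partial sums up to its end and up to the
        end of the preceding block; for \<open>i = 1\<close> the latter is empty.\<close>
      have "(\<lambda>n. (\<Sum>k=1..codim i. benettin_output \<Phi> h (transpose v) k n) - (\<Sum>k=1..codim (i - 1). benettin_output \<Phi> h (transpose v) k n))
          \<longlonglongrightarrow> (\<Sum>j=1..i. real (m j) * lam j) - (\<Sum>j=1..i - 1. real (m j) * lam j)"
        using i by (intro tendsto_diff lim) auto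
      moreover obtain j where j: "i = Suc j" using i by (cases i) auto
      moreover have "(\<Sum>k=1..codim i. f k) - (\<Sum>k=1..codim (i - 1). f k) = (\<Sum>k=codim (i - 1) + 1..codim i. f k)" for f :: "nat \<Rightarrow> real"
        using sum_over_blocks[of f i] sum_over_blocks[of f "i - 1"] by (simp add: j)
      ultimately show ?thesis by simp
    qed
    have simple: "benettin_output \<Phi> h (transpose v) i \<longlonglongrightarrow> lam i"
      if h: "?steps h \<epsilon>" and m: "\<forall>i\<in>{1..q}. m i = 1" and i: "i \<in> {1..q}" for h i
    proof -
      have "codim j = j" if "j \<le> q" for j
        using that m by (simp add: codim_def)
      then show ?thesis
        using block[OF h i] i m by (cases i) auto
    qed
    show ?case
    proof (intro exI[of _ \<epsilon>] conjI allI impI)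
      show "0 < \<epsilon>" by (rule \<epsilon>(1))
      fix h :: "nat \<Rightarrow> real"
      assume h: "\<forall>n\<ge>1. 0 < h n \<and> h n \<le> hmax" "filterlim (grid h) at_top sequentially"
        "summable (\<lambda>n. h (Suc n) powr (p + 1))" "(\<Sum>n. h (Suc n) powr (p + 1)) < \<epsilon>"
      show "\<forall>i\<in>{1..q}. (\<lambda>n. \<Sum>k = (\<Sum>j=1..i - 1. m j) + 1..(\<Sum>j=1..i. m j).
          benettin_output \<Phi> h (transpose v) k n) \<longlonglongrightarrow> real (m i) * lam i"
        using block[unfolded codim_def, of h] h by simp
      assume "\<forall>i\<in>{1..q}. m i = 1"
      then show "\<forall>i\<in>{1..q}. benettin_output \<Phi> h (transpose v) i \<longlonglongrightarrow> lam i"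
        using simple[of h] h by simp
    qed
  qed
qed

end
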